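(* Let $(\lambda_0,u_0)\in\mathbb{R}^m\times W$, put $f_0=0\in\mathbb{R}^q$, $x_0=(f_0,\lambda_0,u_0)\in X$, let $\theta_0\in\mathbb{R}^{q+m}$, and fix a basis $\{\delta_i^{q+m}\}_{i=1,\dots,q+m}$ of $\mathbb{R}^{q+m}$ and a basis $\{\delta_k^n\}_{k=1,\dots,n}$ of $\mathbb{R}^n$. The following statements (i) and (ii) are equivalent. (i) All of the following hold: $(\lambda_0,u_0)$ is a solution of $F(\lambda,u)=0$; $D_uF(\lambda_0,u_0)$ is a Fredholm operator of $W$ to $Z$ with index zero, with $n=\dim\mathrm{Ker}(D_uF(\lambda_0,u_0))\ge1$ and $q=\mathrm{codim}\,\mathrm{Range}(DF(\lambda_0,u_0))\ge1$; $\bar a_1,\dots,\bar a_q$ are linearly independent and $Z=\mathrm{span}\{\bar a_1,\dots,\bar a_q\}\oplus\mathrm{Range}(DF(\lambda_0,u_0))$; $\bar b_1,\dots,\bar b_n$ are linearly independent and $Z=\mathrm{span}\{\bar b_1,\dots,\bar b_n\}\oplus\mathrm{Range}(D_uF(\lambda_0,u_0))$; $x_0$ is the unique solution of $G(x)=0$; $\mathrm{Ker}(DG(x_0))\cap\mathrm{Ker}(B)=\{0\}$ and $\mathrm{Ker}(H(\lambda_0,u_0,\cdot))\cap\mathrm{Ker}(\bar{\mathcal B})=\{0\}$, where these kernels are given by $\mathrm{Ker}(DG(x_0))=\{(g,\mu,w)\in X: g=0,\ (\mu,w)\in\mathrm{Ker}(DF(\lambda_0,u_0))\}$ and $\mathrm{Ker}(H(\lambda_0,u_0,\cdot))=\{(e,v)\in\Delta: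 e=0,\ v\in\mathrm{Ker}(D_uF(\lambda_0,u_0))\}$; and $\theta_0=B(x_0)\in\mathbb{R}^{q+m}$. (ii) Both of the following hold: (a) The system $S(s)=0$ has the solution $s_0=(x_0,y_{1,0},\dots,y_{q+m,0},\mathrm{z}_{1,0},\dots,\mathrm{z}_{n,0})$, where $x_0=(f_0,\lambda_0,u_0)$, $y_{i,0}=(g_{i,0},\mu_{i,0},w_{i,0})$, $\mathrm{z}_{k,0}=(e_{k,0},v_{k,0})$, with $f_0=0$, $g_{i,0}=0$, $e_{k,0}=0$ for $i=1,\dots,q+m$, $k=1,\dots,n$, and the component $x_0$ of $s_0$ is the solution of $\Psi(x)=0$. (b) $D\Psi(x_0)$ is an isomorphism of $X$ onto $Y$, and $DS(s_0)$ is an isomorphism of $\Gamma$ onto $\Sigma$.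
   Context: $W,Z$ are real Banach spaces, both infinite-dimensional or both finite-dimensional; $m\ge1$, $p\ge2$, $q\ge1$, $n\ge1$ are integers; $F:\mathbb{R}^m\times W\to Z$ is of class $C^p$; $\bar a_1,\dots,\bar a_q,\bar b_1,\dots,\bar b_n\in Z\setminus\{0\}$. Put $X=\mathbb{R}^q\times\mathbb{R}^m\times W$ (that is, $\mathbb{R}^{q+m}\times W$), $Y=\mathbb{R}^{q+m}\times Z$, $\Delta=\mathbb{R}^n\times W$, with elements $x=(f,\lambda,u)\in X$, $y=(g,\mu,w)\in X$, $\mathrm{z}=(e,v)\in\Delta$. Finite products of normed spaces carry the sum norm; an isomorphism is a continuous linear bijection with continuous inverse. $G:X\to Z$, $G(f,\lambda,u)=F(\lambda,u)-\sum_{i=1}^q f^i\bar a_i$. $H:\mathbb{R}^m\times W\times\Delta\to Z$, $H(\lambda,u,(e,v))=D_uF(\lambda,u)v-\sum_{k=1}^n e^k\bar b_k$. $B=(\chi_1,\dots,\chi_{q+m})\in L(X,\mathbb{R}^{q+m})$ and $\bar{\mathcal B}=(\bar\chi_1,\dots,\bar\chi_n)\in L(\Delta,\mathbb{R}^n)$, where the $\chi_j$ are nonzero linear forms on $X$ and the $\bar\chi_k$ are nonzero linear forms on $\Delta$. $\Psi:X\to Y$, $\Psi(x)=(B(x)-\theta_0,\,G(x))$. For $x=(f,\lambda,u)$: $\Phi_G(x,y)=(B(y),DG(x)y)\in Y$ and $\Phi_H(x,\mathrm{z})=(\bar{\mathcal B}(\mathrm{z}),H(\lambda,u,\mathrm{z}))\in\mathbb{R}^n\times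 Z$. $\Gamma=X^{1+q+m}\times\Delta^n$, with elements $s=(x,y_1,\dots,y_{q+m},\mathrm{z}_1,\dots,\mathrm{z}_n)$; $\Sigma=Y^{1+q+m}\times(\mathbb{R}^n\times Z)^n$. The function $S:\Gamma\to\Sigma$ is $$S(s)=\big(\Psi(x),\ (\Phi_G(x,y_i)-(\delta_i^{q+m},0))_{i=1,\dots,q+m},\ (\Phi_H(x,\mathrm{z}_k)-(\delta_k^n,0))_{k=1,\dots,n}\big).$$
   Formalization: In (i), "x_0 is the unique solution of G(x)=0" is read as: x_0 is the only solution of the form (f,λ_0,u_0). Uniqueness in all of X is incompatible with the rest of (i), since the zeros of G near x_0 form a (q+m)-dimensional manifold, while (ii) can hold. *)

theory Defs
  imports "HOL-Analysis.Analysis" "HOL-Library.Set_Algebras"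
begin

text \<open>
  \<open>\<real>\<^sup>k\<close> is \<open>real ^ 'k\<close> with \<open>k = CARD('k)\<close>; for \<open>k = q + m\<close> the index type is the sum
  type \<open>'q + 'm\<close>. Finite powers of a normed space are \<open>vec\<close> types as well. The library norm on
  products and powers is the Euclidean combination of the norms, which is equivalent to the sum norm;
  everything below depends on norms only up to equivalence.
\<close>

type_synonym ('q, 'm, 'w) X_space = "(real ^ 'q) \<times> (real ^ 'm) \<times> 'w"
type_synonym ('q, 'm, 'z) Y_space = "(real ^ ('q + 'm)) \<times> 'z"
type_synonym ('n, 'w) Delta_space = "(real ^ 'n) \<times> 'w"
type_synonym ('q, 'm, 'n, 'w) Gamma_space =
  "('q, 'm, 'w) X_space \<times> (('q, 'm, 'w) X_space ^ ('q + 'm)) \<times> (('n, 'w) Delta_space ^ 'n)"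
type_synonym ('q, 'm, 'n, 'z) Sigma_space =
  "('q, 'm, 'z) Y_space \<times> (('q, 'm, 'z) Y_space ^ ('q + 'm)) \<times> (((real ^ 'n) \<times> 'z) ^ 'n)"


section \<open>Maps of class \<open>C\<^sup>p\<close> between normed spaces\<close>

text \<open>
  The \<open>k\<close>-th derivative of \<open>f\<close> at \<open>x\<close> is a bounded \<open>k\<close>-linear map, represented as a function on lists
  of length \<open>k\<close> (its values on other lists are irrelevant). Differentiability and continuity are with
  respect to the norm of bounded multilinear maps, the supremum of \<open>norm (A vs) / (\<Prod>i. norm (vs ! i))\<close>,
  hence the bounds that are uniform in \<open>vs\<close>.
\<close>

definition bounded_multilinear ::
    "nat \<Rightarrow> ('a::real_normed_vector list \<Rightarrow> 'b::real_normed_vector) \<Rightarrow> bool" where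
  "bounded_multilinear k A \<longleftrightarrow>
     (\<forall>vs i. length vs = k \<longrightarrow> i < k \<longrightarrow> linear (\<lambda>v. A (vs[i := v]))) \<and>
     (\<exists>K. \<forall>vs. length vs = k \<longrightarrow> norm (A vs) \<le> K * prod_list (map norm vs))"

definition class_C :: "nat \<Rightarrow> ('a::real_normed_vector \<Rightarrow> 'b::real_normed_vector) \<Rightarrow> bool" where
  "class_C p f \<longleftrightarrow>
     (\<exists>D :: nat \<Rightarrow> 'a \<Rightarrow> 'a list \<Rightarrow> 'b.
        (\<forall>x. D 0 x [] = f x) \<and>
        (\<forall>k\<le>p. \<forall>x. bounded_multilinear k (D k x)) \<and>
        (\<forall>k<p. \<forall>x. \<forall>\<epsilon>>0. \<forall>\<^sub>F y in nhds x. \<forall>vs. length vs = k \<longrightarrow>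
           norm (D k y vs - D k x vs - D (Suc k) x ((y - x) # vs))
             \<le> \<epsilon> * norm (y - x) * prod_list (map norm vs)) \<and>
        (\<forall>x. \<forall>\<epsilon>>0. \<forall>\<^sub>F y in nhds x. \<forall>vs. length vs = p \<longrightarrow>
           norm (D p y vs - D p x vs) \<le> \<epsilon> * prod_list (map norm vs)))"


section \<open>Linear algebra and Fredholm operators\<close>

definition Ker :: "('a \<Rightarrow> 'b::zero) \<Rightarrow> 'a set" where
  "Ker T = {x. T x = 0}"

text \<open>The constant \<open>dim\<close> returns \<open>0\<close> on infinite-dimensional spaces, so finiteness is tracked separately.\<close>

definition finite_dim :: "'a::real_vector set \<Rightarrow> bool" where
  "finite_dim V \<longleftrightarrow> (\<exists>A. finite A \<and> V \<subseteq> span A)"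

definition lin_indep_family :: "('i \<Rightarrow> 'a::real_vector) \<Rightarrow> bool" where
  "lin_indep_family a \<longleftrightarrow> inj a \<and> independent (range a)"

definition basis_family :: "('i \<Rightarrow> 'a::real_vector) \<Rightarrow> bool" where
  "basis_family a \<longleftrightarrow> lin_indep_family a \<and> span (range a) = UNIV"

text \<open>The whole space is the (algebraic) direct sum of the subspaces \<open>U\<close> and \<open>V\<close>.\<close>

definition direct_sum_UNIV :: "'a::real_vector set \<Rightarrow> 'a set \<Rightarrow> bool" where
  "direct_sum_UNIV U V \<longleftrightarrow> subspace U \<and> subspace V \<and> U \<inter> V = {0} \<and> U + V = UNIV"

text \<open>
  The codimension of \<open>V\<close> is the dimension of a complement of \<open>V\<close>; all complements are isomorphic
  to the quotient by \<open>V\<close>.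
\<close>

definition finite_codim :: "'a::real_vector set \<Rightarrow> bool" where
  "finite_codim V \<longleftrightarrow> (\<exists>C. direct_sum_UNIV C V \<and> finite_dim C)"

definition codim :: "'a::real_vector set \<Rightarrow> nat" where
  "codim V = dim (SOME C. direct_sum_UNIV C V)"

definition fredholm :: "('a::real_normed_vector \<Rightarrow> 'b::real_normed_vector) \<Rightarrow> bool" where
  "fredholm T \<longleftrightarrow>
     bounded_linear T \<and> finite_dim (Ker T) \<and> closed (range T) \<and> finite_codim (range T)"

definition fredholm_index :: "('a::real_normed_vector \<Rightarrow> 'b::real_normed_vector) \<Rightarrow> int" where
  "fredholm_index T = int (dim (Ker T)) - int (codim (range T))"

definition isomorphism :: "('a::real_normed_vector \<Rightarrow> 'b::real_normed_vector) \<Rightarrow> bool" where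
  "isomorphism T \<longleftrightarrow> bounded_linear T \<and> bij T \<and> continuous_on UNIV (inv T)"


section \<open>The maps of the extended system\<close>

abbreviation Dif ::
    "('a::real_normed_vector \<Rightarrow> 'b::real_normed_vector) \<Rightarrow> 'a \<Rightarrow> 'a \<Rightarrow> 'b" where
  "Dif f x \<equiv> frechet_derivative f (at x)"

definition D_u ::
    "((real ^ 'm) \<times> 'w::real_normed_vector \<Rightarrow> 'z::real_normed_vector)
      \<Rightarrow> real ^ 'm \<Rightarrow> 'w \<Rightarrow> 'w \<Rightarrow> 'z" where
  "D_u F l u = Dif (\<lambda>u'. F (l, u')) u"

definition G_map ::
    "((real ^ 'm) \<times> 'w::real_normed_vector \<Rightarrow> 'z::real_normed_vector) \<Rightarrow> ('q::finite \<Rightarrow> 'z)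
      \<Rightarrow> ('q, 'm, 'w) X_space \<Rightarrow> 'z" where
  "G_map F a = (\<lambda>(f, l, u). F (l, u) - (\<Sum>i\<in>UNIV. f $ i *\<^sub>R a i))"

definition H_map ::
    "((real ^ 'm) \<times> 'w::real_normed_vector \<Rightarrow> 'z::real_normed_vector) \<Rightarrow> ('n::finite \<Rightarrow> 'z)
      \<Rightarrow> real ^ 'm \<Rightarrow> 'w \<Rightarrow> ('n, 'w) Delta_space \<Rightarrow> 'z" where
  "H_map F b l u = (\<lambda>(e, v). D_u F l u v - (\<Sum>k\<in>UNIV. e $ k *\<^sub>R b k))"

definition Psi_map ::
    "((real ^ 'm::finite) \<times> 'w::real_normed_vector \<Rightarrow> 'z::real_normed_vector)
      \<Rightarrow> ('q::finite \<Rightarrow> 'z) \<Rightarrow> (('q, 'm, 'w) X_space \<Rightarrow> real ^ ('q + 'm)) \<Rightarrow> real ^ ('q + 'm)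
      \<Rightarrow> ('q, 'm, 'w) X_space \<Rightarrow> ('q, 'm, 'z) Y_space" where
  "Psi_map F a B \<theta> x = (B x - \<theta>, G_map F a x)"

definition Phi_G ::
    "((real ^ 'm::finite) \<times> 'w::real_normed_vector \<Rightarrow> 'z::real_normed_vector)
      \<Rightarrow> ('q::finite \<Rightarrow> 'z) \<Rightarrow> (('q, 'm, 'w) X_space \<Rightarrow> real ^ ('q + 'm))
      \<Rightarrow> ('q, 'm, 'w) X_space \<Rightarrow> ('q, 'm, 'w) X_space \<Rightarrow> ('q, 'm, 'z) Y_space" where
  "Phi_G F a B x y = (B y, Dif (G_map F a) x y)"

definition Phi_H ::
    "((real ^ 'm::finite) \<times> 'w::real_normed_vector \<Rightarrow> 'z::real_normed_vector)
      \<Rightarrow> ('n::finite \<Rightarrow> 'z) \<Rightarrow> (('n, 'w) Delta_space \<Rightarrow> real ^ 'n)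
      \<Rightarrow> ('q::finite, 'm, 'w) X_space \<Rightarrow> ('n, 'w) Delta_space \<Rightarrow> (real ^ 'n) \<times> 'z" where
  "Phi_H F b Bb = (\<lambda>(f, l, u) z. (Bb z, H_map F b l u z))"

definition S_map ::
    "((real ^ 'm::finite) \<times> 'w::real_normed_vector \<Rightarrow> 'z::real_normed_vector)
      \<Rightarrow> ('q::finite \<Rightarrow> 'z) \<Rightarrow> ('n::finite \<Rightarrow> 'z)
      \<Rightarrow> (('q, 'm, 'w) X_space \<Rightarrow> real ^ ('q + 'm)) \<Rightarrow> (('n, 'w) Delta_space \<Rightarrow> real ^ 'n)
      \<Rightarrow> real ^ ('q + 'm) \<Rightarrow> ('q + 'm \<Rightarrow> real ^ ('q + 'm)) \<Rightarrow> ('n \<Rightarrow> real ^ 'n)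
      \<Rightarrow> ('q, 'm, 'n, 'w) Gamma_space \<Rightarrow> ('q, 'm, 'n, 'z) Sigma_space" where
  "S_map F a b B Bb \<theta> \<delta> \<delta>' = (\<lambda>(x, ys, zs).
     (Psi_map F a B \<theta> x,
      (\<chi> i. Phi_G F a B x (ys $ i) - (\<delta> i, 0)),
      (\<chi> k. Phi_H F b Bb x (zs $ k) - (\<delta>' k, 0))))"

text \<open>
  The point \<open>x\<^sub>0 = (f\<^sub>0, l\<^sub>0, u\<^sub>0)\<close> is the unique solution of \<open>G x = 0\<close> at the given \<open>(l\<^sub>0, u\<^sub>0)\<close>.
  Uniqueness among all \<open>x\<close> cannot be meant: where \<open>DG x\<^sub>0\<close> is onto with a kernel of dimension
  \<open>q + m\<close>, the zeros of \<open>G\<close> near \<open>x\<^sub>0\<close> form a manifold of dimension \<open>q + m \<ge> 1\<close>.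
\<close>

definition unique_solution_at ::
    "(('q, 'm, 'w) X_space \<Rightarrow> 'z::zero) \<Rightarrow> ('q, 'm, 'w) X_space \<Rightarrow> bool" where
  "unique_solution_at G x0 \<longleftrightarrow> (\<forall>x. (G x = 0 \<and> snd x = snd x0) \<longleftrightarrow> x = x0)"

end

theory Submission imports Defs begin

text \<open>
  The derivative of \<open>S\<close> at \<open>s\<^sub>0\<close> is block triangular, with the operators \<open>A = D\<Psi>(x\<^sub>0) = \<Phi>\<^sub>G(x\<^sub>0, \<cdot>)\<close>
  (\<open>1 + q + m\<close> times) and \<open>C = \<Phi>\<^sub>H(x\<^sub>0, \<cdot>)\<close> (\<open>n\<close> times) on the diagonal, so by the bounded inverse
  theorem statement (ii)(b) says that \<open>A\<close> and \<open>C\<close> are bijective. If they are, the vectors \<open>y\<^sub>i\<close> and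
  \<open>z\<^sub>k\<close>, being the preimages of bases, span the kernels of \<open>DG(x\<^sub>0)\<close> and \<open>H(\<lambda>\<^sub>0, u\<^sub>0, \<cdot>)\<close>; since their
  first components vanish, these kernels lie in \<open>{0} \<times> (\<real>\<^sup>m \<times> W)\<close> and \<open>{0} \<times> W\<close>, which together with
  surjectivity is a restatement of the two direct sum decompositions. Conversely, (i) makes \<open>C\<close>
  bijective by a dimension count on its kernel. As \<open>A\<close> is, up to summands \<open>\<real>\<^sup>k\<close>, a
  finite-rank perturbation of \<open>C\<close>, it is bijective because it is injective.
\<close>

section \<open>The bounded inverse theorem\<close>

text \<open>By Baire, the closure of the image of some ball has an interior point; symmetry moves it
  to the origin and scaling extends the estimate to all of \<open>'b\<close>. An error of half of
  \<open>norm y\<close> suffices because the correction can be iterated.\<close>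

lemma bounded_inverse_approx:
  fixes T :: "'a::banach \<Rightarrow> 'b::banach"
  assumes T: "bounded_linear T" and surj: "surj T"
  obtains M where "M > 0" "\<And>y. \<exists>x. norm x \<le> M * norm y \<and> norm (y - T x) \<le> norm y / 2"
proof -
  interpret T: bounded_linear T by fact
  define A where "A n = closure (T ` ball 0 (real n))" for n
  have cover: "(\<Union>n. A n) = UNIV"
  proof -
    have "y \<in> (\<Union>n. A n)" for y
    proof -
      obtain x where "y = T x" using surj by blast
      moreover obtain n where "norm x < real n" using reals_Archimedean2 by blast
      ultimately have "y \<in> T ` ball 0 (real n)" by simp
      then show ?thesis using closure_subset[of "T ` ball 0 (real n)"] unfolding A_def by blast
    qed
    then show ?thesis by blast
  qed
  have "\<exists>n. interior (A n) \<noteq> {}"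
  proof (rule ccontr)
    assume "\<not> ?thesis"
    \<comment> \<open>Baire: a countable union of closed sets with empty interior has empty
      interior, but here the union is the whole space.\<close>
    then have "euclidean interior_of \<Union>(range A) = {}"
      by (intro Baire_category_alt) (auto simp: completely_metrizable_space_euclidean A_def)
    then show False
      using cover by simp
  qed
  then obtain n y0 where "y0 \<in> interior (A n)" by blast
  then obtain r where r: "r > 0" "ball y0 r \<subseteq> A n"
    by (meson mem_interior)
  \<comment> \<open>\<open>y\<close> is half the difference of \<open>y0 + y\<close> and
    \<open>y0 - y\<close>, both in the ball around \<open>y0\<close>, so half the difference of
    their approximate preimages serves for \<open>y\<close>.\<close>
  have approx: "\<exists>x. norm x < real n \<and> norm (y - T x) < e" if y: "norm y < r" and e: "e > 0" for y e
  proof -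
    have "y0 + y \<in> A n" "y0 - y \<in> A n"
      using r y by (auto simp: subset_iff dist_norm)
    then obtain u v where uv: "norm u < real n" "norm v < real n"
        "dist (T u) (y0 + y) < e" "dist (T v) (y0 - y) < e"
      using e unfolding A_def closure_approachable by fastforce
    define x where "x = (1 / 2) *\<^sub>R (u - v)"
    have "norm x \<le> (norm u + norm v) / 2"
      unfolding x_def using norm_triangle_ineq4[of u v] by simp
    then have "norm x < real n" using uv by simp
    moreover have "y - T x = (1 / 2) *\<^sub>R ((y0 + y - T u) - (y0 - y - T v))"
      by (simp add: x_def T.scaleR T.diff algebra_simps flip: scaleR_add_left)
    then have "norm (y - T x) \<le> (norm (y0 + y - T u) + norm (y0 - y - T v)) / 2"
      using norm_triangle_ineq4[of "y0 + y - T u" "y0 - y - T v"] by simp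
    then have "norm (y - T x) < e"
      using uv(3,4) by (simp add: dist_norm norm_minus_commute)
    ultimately show ?thesis by blast
  qed
  have n: "real n > 0" using approx[of 0 1] r by (metis norm_ge_zero norm_zero order_le_less_trans zero_less_one)
  define M where "M = 2 * real n / r"
  have "\<exists>x. norm x \<le> M * norm y \<and> norm (y - T x) \<le> norm y / 2" for y
  proof (cases "y = 0")
    case True
    then show ?thesis by (intro exI[of _ 0]) (simp add: T.zero)
  next
    case False
    \<comment> \<open>Scaling by \<open>c\<close> brings \<open>y\<close> to norm
      \<open>r / 2\<close>, inside the admissible ball. Dividing by \<open>c\<close> afterwards
      turns the bound \<open>real n\<close> into \<open>M * norm y\<close> and the tolerance
      \<open>c * norm y / 2\<close> into \<open>norm y / 2\<close>.\<close>
    define c where "c = r / (2 * norm y)"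
    have c: "c > 0" using False r by (simp add: c_def)
    have "norm (c *\<^sub>R y) < r" using False r by (simp add: c_def)
    moreover have "c * norm y / 2 > 0" using c False by simp
    ultimately obtain x where x: "norm x < real n" "norm (c *\<^sub>R y - T x) < c * norm y / 2"
      using approx by blast
    have "norm ((1 / c) *\<^sub>R x) \<le> real n / c"
      using x c by (simp add: divide_right_mono)
    also have "\<dots> = M * norm y"
      by (simp add: c_def M_def)
    finally have 1: "norm ((1 / c) *\<^sub>R x) \<le> M * norm y" .
    have "y - T ((1 / c) *\<^sub>R x) = (1 / c) *\<^sub>R (c *\<^sub>R y - T x)"
      using c by (simp add: T.scaleR algebra_simps)
    then have "norm (y - T ((1 / c) *\<^sub>R x)) = norm (c *\<^sub>R y - T x) / c"
      using c by simp
    also have "\<dots> \<le> norm y / 2"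
      using x c by (simp add: field_simps)
    finally show ?thesis using 1 by blast
  qed
  moreover have "M > 0" using n r by (simp add: M_def)
  ultimately show thesis using that by blast
qed

text \<open>Approximate solutions are applied to successive residuals. These at least halve each
  time, so the corrections form an absolutely convergent series whose sum is the exact preimage; the
  geometric series turns \<open>M\<close> into the bound \<open>2 * M\<close>.\<close>

lemma bounded_inverse:
  fixes T :: "'a::banach \<Rightarrow> 'b::banach"
  assumes T: "bounded_linear T" and bij: "bij T"
  shows "bounded_linear (inv T)"
proof -
  interpret T: bounded_linear T by fact
  obtain M where M: "M > 0" "\<And>y. \<exists>x. norm x \<le> M * norm y \<and> norm (y - T x) \<le> norm y / 2"
    using bounded_inverse_approx[OF T bij_is_surj[OF bij]] by blast
  then obtain g where g: "\<And>y. norm (g y) \<le> M * norm y" "\<And>y. norm (y - T (g y)) \<le> norm y / 2"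
    by metis
  have bound: "norm (inv T y) \<le> 2 * M * norm y" for y
  proof -
    \<comment> \<open>\<open>r k\<close> is what remains of \<open>y\<close> after \<open>k\<close>
      corrections, so the images of the corrections telescope to \<open>r 0 = y\<close>.\<close>
    define r where "r = rec_nat y (\<lambda>_ v. v - T (g v))"
    have r0: "r 0 = y" and rS: "r (Suc k) = r k - T (g (r k))" for k
      by (simp_all add: r_def)
    have nr: "norm (r k) \<le> norm y * (1 / 2) ^ k" for k
    proof (induction k)
      case (Suc k)
      have "norm (r (Suc k)) \<le> norm (r k) / 2"
        unfolding rS by (rule g)
      with Suc show ?case by simp
    qed (simp add: r0)
    have ng: "norm (g (r k)) \<le> M * norm y * (1 / 2) ^ k" for k
      using order_trans[OF g(1) mult_left_mono[OF nr less_imp_le[OF M(1)]]] by (simp add: mult.assoc)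
    have sm: "(\<lambda>k. M * norm y * (1 / 2) ^ k) sums (M * norm y * 2)"
      using sums_mult[OF geometric_sums[of "1/2::real"], of "M * norm y"] by simp
    define x where "x = (\<Sum>k. g (r k))"
    have summ: "summable (\<lambda>k. g (r k))"
      by (rule summable_comparison_test_ev[OF always_eventually sums_summable[OF sm]]) (use ng in blast)
    then have "(\<lambda>k. T (g (r k))) sums T x"
      unfolding x_def by (intro T.sums summable_sums)
    moreover have "(\<lambda>k. T (g (r k))) sums y"
    proof -
      have "r \<longlonglongrightarrow> 0"
      proof (rule Lim_null_comparison)
        show "(\<lambda>k. norm y * (1 / 2) ^ k) \<longlonglongrightarrow> 0"
          by (intro tendsto_mult_right_zero LIMSEQ_realpow_zero) auto
      qed (use nr in simp)
      from telescope_sums'[OF this] show ?thesis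
        by (simp add: r0 rS)
    qed
    ultimately have "T x = y" by (rule sums_unique2)
    then have x: "inv T y = x" using bij by (metis bij_inv_eq_iff)
    have "norm x \<le> (\<Sum>k. M * norm y * (1 / 2) ^ k)"
      unfolding x_def using ng sm by (intro norm_suminf_le) (auto simp: sums_iff)
    also have "\<dots> = 2 * M * norm y" using sm by (simp add: sums_iff)
    finally show ?thesis using x by simp
  qed
  show ?thesis
  proof (rule bounded_linear_intro[where K = "2 * M"])
    fix y z and c :: real
    have surj: "T (inv T v) = v" for v by (simp add: bij bij_is_surj surj_f_inv_f)
    have inj: "inv T (T v) = v" for v by (simp add: bij bij_is_inj)
    show "inv T (y + z) = inv T y + inv T z" by (metis T.add inj surj)
    show "inv T (c *\<^sub>R y) = c *\<^sub>R inv T y" by (metis T.scaleR inj surj)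
    show "norm (inv T y) \<le> norm y * (2 * M)" using bound by (simp add: mult.commute)
  qed
qed

text \<open>Completeness makes continuity of the inverse automatic, which reduces the isomorphism
  conditions of the theorem to linear algebra.\<close>

lemma isomorphism_iff_bij:
  fixes T :: "'a::banach \<Rightarrow> 'b::banach"
  assumes "bounded_linear T"
  shows "isomorphism T \<longleftrightarrow> bij T"
  using assms bounded_inverse linear_continuous_on unfolding isomorphism_def by blast

section \<open>Linear algebra\<close>

lemma surj_if_ex: "(\<And>y. \<exists>x. f x = y) \<Longrightarrow> surj f"
  unfolding surj_def by (metis (no_types))

lemma in_span_range_iff:
  fixes a :: "'i::finite \<Rightarrow> 'a::real_vector"
  shows "x \<in> span (range a) \<longleftrightarrow> (\<exists>c. x = (\<Sum>i\<in>UNIV. c i *\<^sub>R a i))"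
proof
  let ?S = "{x. \<exists>c. x = (\<Sum>i\<in>UNIV. c i *\<^sub>R a i)}"
  have "subspace ?S"
    unfolding subspace_def
  proof (intro conjI ballI allI)
    show "0 \<in> ?S" by (auto intro!: exI[of _ "\<lambda>_. 0"])
  next
    fix x y assume "x \<in> ?S" "y \<in> ?S"
    then obtain c d where "x = (\<Sum>i\<in>UNIV. c i *\<^sub>R a i)" "y = (\<Sum>i\<in>UNIV. d i *\<^sub>R a i)" by auto
    then show "x + y \<in> ?S"
      by (auto intro!: exI[of _ "\<lambda>i. c i + d i"] simp: scaleR_add_left sum.distrib)
  next
    fix r :: real and x assume "x \<in> ?S"
    then obtain c where "x = (\<Sum>i\<in>UNIV. c i *\<^sub>R a i)" by auto
    then show "r *\<^sub>R x \<in> ?S"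
      by (auto intro!: exI[of _ "\<lambda>i. r * c i"] simp: scaleR_sum_right)
  qed
  moreover have "a i \<in> ?S" for i
    by (auto intro!: exI[of _ "\<lambda>j. if j = i then 1 else 0"] simp: if_distrib[of "\<lambda>r. r *\<^sub>R _"] cong: if_cong)
  ultimately show "\<exists>c. x = (\<Sum>i\<in>UNIV. c i *\<^sub>R a i)" if "x \<in> span (range a)"
    using span_minimal[of "range a" ?S] that by blast
qed (clarify, intro span_sum span_scale span_base rangeI)

lemma lin_indep_family_iff:
  fixes a :: "'i::finite \<Rightarrow> 'a::real_vector"
  shows "lin_indep_family a \<longleftrightarrow> (\<forall>c. (\<Sum>i\<in>UNIV. c i *\<^sub>R a i) = 0 \<longrightarrow> (\<forall>i. c i = 0))"
proof
  assume a: "lin_indep_family a"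
  then have inj: "inj a" by (simp add: lin_indep_family_def)
  show "\<forall>c. (\<Sum>i\<in>UNIV. c i *\<^sub>R a i) = 0 \<longrightarrow> (\<forall>i. c i = 0)"
  proof (intro allI impI)
    fix c i assume "(\<Sum>i\<in>UNIV. c i *\<^sub>R a i) = 0"
    then have "(\<Sum>v\<in>range a. c (inv a v) *\<^sub>R v) = 0"
      using inj by (simp add: sum.reindex)
    moreover have "independent (range a)" using a by (simp add: lin_indep_family_def)
    ultimately have "c (inv a (a i)) = 0"
      by (intro independentD[of "range a" "range a" "\<lambda>v. c (inv a v)"]) auto
    then show "c i = 0" using inj by simp
  qed
next
  assume c: "\<forall>c. (\<Sum>i\<in>UNIV. c i *\<^sub>R a i) = 0 \<longrightarrow> (\<forall>i. c i = 0)"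
  have inj: "inj a"
  proof (rule injI, rule ccontr)
    fix i j assume ij: "a i = a j" "i \<noteq> j"
    \<comment> \<open>Coefficients 1 at \<open>i\<close> and -1 at \<open>j\<close> give a
      nontrivial relation when \<open>a i = a j\<close>.\<close>
    let ?c = "\<lambda>k. (if k = i then 1 else 0) - (if k = j then 1 else 0) :: real"
    have "(\<Sum>k\<in>UNIV. ?c k *\<^sub>R a k) = 0"
      using ij by (simp add: scaleR_diff_left sum_subtractf if_distrib[of "\<lambda>r. r *\<^sub>R _"] cong: if_cong)
    from c[rule_format, OF this, of i] ij show False by simp
  qed
  have "independent (range a)"
  proof (rule independent_if_scalars_zero)
    fix f x assume f: "(\<Sum>x\<in>range a. f x *\<^sub>R x) = 0" and "x \<in> range a"
    then show "f x = 0"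
      using c[rule_format, of "f \<circ> a"] inj by (auto simp: sum.reindex)
  qed simp
  with inj show "lin_indep_family a" by (simp add: lin_indep_family_def)
qed

lemma lin_indep_family_linear_preimage:
  fixes v :: "'i::finite \<Rightarrow> 'a::real_vector" and f :: "'a \<Rightarrow> 'b::real_vector"
  assumes f: "linear f" and indep: "lin_indep_family (\<lambda>i. f (v i))"
  shows "lin_indep_family v"
  unfolding lin_indep_family_iff
proof (intro allI impI)
  fix c i assume "(\<Sum>i\<in>UNIV. c i *\<^sub>R v i) = 0"
  then have "f (\<Sum>i\<in>UNIV. c i *\<^sub>R v i) = 0" by (simp add: linear_0[OF f])
  then have "(\<Sum>i\<in>UNIV. c i *\<^sub>R f (v i)) = 0"
    by (simp add: linear_sum[OF f] linear_scale[OF f])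
  then show "c i = 0" using indep unfolding lin_indep_family_iff by blast
qed

lemma dim_span_lin_indep_family:
  fixes a :: "'i::finite \<Rightarrow> 'a::real_vector"
  assumes "lin_indep_family a"
  shows "dim (span (range a)) = CARD('i)"
  using assms unfolding lin_indep_family_def
  by (simp add: dim_eq_card_independent card_image)

text \<open>The projection onto \<open>C\<close> along \<open>V\<close> restricts to a linear
  bijection of \<open>U\<close> onto \<open>C\<close> and carries a basis to a basis. Hence
  \<open>codim\<close>, which chooses an arbitrary complement, can be computed from any
  complement.\<close>

lemma dim_complement_unique:
  fixes U C V :: "'a::real_vector set"
  assumes U: "direct_sum_UNIV U V" and C: "direct_sum_UNIV C V"
  shows "dim C = dim U"
proof -
  have sV: "subspace V" and sU: "subspace U" and sC: "subspace C"
    and UV: "U \<inter> V = {0}" "U + V = UNIV" and CV: "C \<inter> V = {0}" "C + V = UNIV"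
    using U C by (auto simp: direct_sum_UNIV_def)
  define \<pi> where "\<pi> z = (SOME c. c \<in> C \<and> z - c \<in> V)" for z
  have \<pi>: "\<pi> z \<in> C \<and> z - \<pi> z \<in> V" for z
    unfolding \<pi>_def
  proof (rule someI_ex)
    obtain c v where "c \<in> C" "v \<in> V" "z = c + v"
      using CV(2) by (metis UNIV_I set_plus_elim)
    then show "\<exists>c. c \<in> C \<and> z - c \<in> V" by auto
  qed
  \<comment> \<open>Two candidates for the projection differ by an element of
    \<open>C \<inter> V = {0}\<close>. Linearity of \<open>\<pi>\<close> and its image on
    \<open>U\<close> both follow from this uniqueness.\<close>
  have \<pi>_eq: "\<pi> z = c" if "c \<in> C" "z - c \<in> V" for z c
  proof -
    have "(z - c) - (z - \<pi> z) \<in> V" by (rule subspace_diff[OF sV]) (use that \<pi> in auto)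
    then have "\<pi> z - c \<in> V" by simp
    moreover have "\<pi> z - c \<in> C" by (rule subspace_diff[OF sC]) (use that \<pi> in auto)
    ultimately have "\<pi> z - c \<in> C \<inter> V" by (rule IntI[rotated])
    then show ?thesis unfolding CV(1) by simp
  qed
  have lin: "linear \<pi>"
  proof (rule linearI)
    fix x y :: 'a and r :: real
    have 1: "(x - \<pi> x) + (y - \<pi> y) \<in> V" by (rule subspace_add[OF sV]) (use \<pi> in auto)
    show "\<pi> (x + y) = \<pi> x + \<pi> y"
      by (rule \<pi>_eq, rule subspace_add[OF sC]) (use 1 \<pi> in \<open>auto simp: algebra_simps\<close>)
    have 2: "r *\<^sub>R (x - \<pi> x) \<in> V" by (rule subspace_scale[OF sV]) (use \<pi> in auto)
    show "\<pi> (r *\<^sub>R x) = r *\<^sub>R \<pi> x"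
      by (rule \<pi>_eq, rule subspace_scale[OF sC]) (use 2 \<pi> in \<open>auto simp: algebra_simps\<close>)
  qed
  have inj: "inj_on \<pi> U"
  proof (rule inj_onI)
    fix x y assume xy: "x \<in> U" "y \<in> U" "\<pi> x = \<pi> y"
    have "(x - \<pi> x) - (y - \<pi> y) \<in> V" by (rule subspace_diff[OF sV]) (use \<pi> in auto)
    then have "x - y \<in> V" using xy by simp
    moreover have "x - y \<in> U" by (rule subspace_diff[OF sU]) (use xy in auto)
    ultimately have "x - y \<in> U \<inter> V" by (rule IntI[rotated])
    then show "x = y" unfolding UV(1) by simp
  qed
  have img: "\<pi> ` U = C"
  proof
    show "C \<subseteq> \<pi> ` U"
    proof
      fix c assume c: "c \<in> C"
      obtain u v where uv: "u \<in> U" "v \<in> V" "c = u + v"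
        using UV(2) by (metis UNIV_I set_plus_elim)
      have "u - c \<in> V" using uv sV by (simp add: subspace_neg)
      then show "c \<in> \<pi> ` U" using \<pi>_eq[OF c] uv(1) by auto
    qed
  qed (use \<pi> in auto)
  obtain b where b: "b \<subseteq> U" "independent b" "U \<subseteq> span b" "card b = dim U"
    by (rule basis_exists[of "U"])
  have spb: "span b = U" by (rule subset_antisym[OF span_minimal[OF b(1) sU] b(3)])
  have "independent (\<pi> ` b)"
    using inj spb by (intro linear_independent_injective_image[OF lin b(2)]) simp
  moreover have "span (\<pi> ` b) = span C"
    using linear_span_image[OF lin, of b] spb img sC by (metis span_eq_iff)
  moreover have "card (\<pi> ` b) = card b" using inj b(1) by (meson card_image inj_on_subset)
  ultimately show ?thesis using dim_eq_card[of "\<pi> ` b" C] b(4) by simp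
qed

lemma codim_lin_indep_complement:
  fixes a :: "'i::finite \<Rightarrow> 'a::real_vector"
  assumes a: "lin_indep_family a" and V: "direct_sum_UNIV (span (range a)) V"
  shows "finite_codim V" "codim V = CARD('i)"
proof -
  show "finite_codim V"
    unfolding finite_codim_def finite_dim_def using V by (meson finite finite_imageI subset_refl)
  have "direct_sum_UNIV (SOME C. direct_sum_UNIV C V) V"
    using V by (rule someI)
  then show "codim V = CARD('i)"
    unfolding codim_def using dim_complement_unique[OF V] dim_span_lin_indep_family[OF a] by simp
qed

section \<open>Bordered operators\<close>

text \<open>The common shape of \<open>G_map\<close>, of its derivative and of \<open>H_map\<close>,
  with \<open>M\<close> equal to F, DF and D_uF respectively, so that the same lemmas serve both
  extended operators.\<close>

definition border :: "('u \<Rightarrow> 'z::real_vector) \<Rightarrow> ('k::finite \<Rightarrow> 'z) \<Rightarrow> (real ^ 'k) \<times> 'u \<Rightarrow> 'z" where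
  "border M a = (\<lambda>(g, u). M u - (\<Sum>i\<in>UNIV. g $ i *\<^sub>R a i))"

lemma linear_border:
  assumes "linear M"
  shows "linear (border M a)"
proof (rule linearI; clarify)
  fix g h u v and r :: real
  show "border M a ((g, u) + (h, v)) = border M a (g, u) + border M a (h, v)"
    by (simp add: border_def linear_add[OF assms] scaleR_add_left sum.distrib)
  show "border M a (r *\<^sub>R (g, u)) = r *\<^sub>R border M a (g, u)"
    by (simp add: border_def linear_scale[OF assms] scaleR_sum_right scaleR_diff_right)
qed

text \<open>An equation between a combination of the \<open>a i\<close> and some \<open>M u\<close>
  is a kernel element of \<open>border M a\<close>, so its coefficients vanish by
  \<open>ker\<close>. The case \<open>u = 0\<close> gives independence, general \<open>u\<close> the
  trivial intersection; surjectivity gives the sum.\<close>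

lemma direct_sum_if_border_surj:
  fixes M :: "'u::real_vector \<Rightarrow> 'z::real_vector" and a :: "'k::finite \<Rightarrow> 'z"
  assumes M: "linear M" and surj: "surj (border M a)"
    and ker: "\<And>x. border M a x = 0 \<Longrightarrow> fst x = 0"
  shows "lin_indep_family a" "direct_sum_UNIV (span (range a)) (range M)"
proof -
  have zero: "\<forall>i. c i = 0" if "(\<Sum>i\<in>UNIV. c i *\<^sub>R a i) = M u" for c u
    using ker[of "((\<chi> i. c i), u)"] that by (simp add: border_def vec_eq_iff)
  show "lin_indep_family a"
    unfolding lin_indep_family_iff using zero[of _ 0] linear_0[OF M] by simp
  show "direct_sum_UNIV (span (range a)) (range M)"
    unfolding direct_sum_UNIV_def
  proof (intro conjI)
    show "subspace (range M)" using M by (simp add: linear_subspace_image)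
    show "span (range a) \<inter> range M = {0}"
    proof
      show "span (range a) \<inter> range M \<subseteq> {0}"
      proof clarify
        fix x u assume "M u \<in> span (range a)"
        then obtain c where c: "M u = (\<Sum>i\<in>UNIV. c i *\<^sub>R a i)" unfolding in_span_range_iff by blast
        then show "M u = 0" using zero[OF c[symmetric]] by simp
      qed
      show "{0} \<subseteq> span (range a) \<inter> range M"
        using linear_0[OF M] by (auto simp: span_zero intro: rev_image_eqI[of 0])
    qed
    have "z \<in> span (range a) + range M" for z
    proof -
      obtain g u where "z = border M a (g, u)" using surj by (metis surjD surj_pair)
      then have "z = (\<Sum>i\<in>UNIV. (- g $ i) *\<^sub>R a i) + M u"
        by (simp add: border_def sum_negf)
      moreover have "(\<Sum>i\<in>UNIV. (- g $ i) *\<^sub>R a i) \<in> span (range a)"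
        by (intro span_sum span_scale span_base rangeI)
      ultimately show ?thesis by (metis rangeI set_plus_intro)
    qed
    then show "span (range a) + range M = UNIV" by blast
  qed simp
qed

lemma Ker_border:
  fixes M :: "'u::real_vector \<Rightarrow> 'z::real_vector" and a :: "'k::finite \<Rightarrow> 'z"
  assumes "\<And>x. border M a x = 0 \<Longrightarrow> fst x = 0"
  shows "Ker (border M a) = {(g, u). g = 0 \<and> u \<in> Ker M}"
  using assms by (fastforce simp: Ker_def border_def)

lemma surj_border:
  fixes M :: "'u::real_vector \<Rightarrow> 'z::real_vector" and a :: "'k::finite \<Rightarrow> 'z"
  assumes "direct_sum_UNIV (span (range a)) (range M)"
  shows "surj (border M a)"
proof -
  have "\<exists>x. border M a x = z" for z
  proof -
    have "z \<in> span (range a) + range M" using assms by (simp add: direct_sum_UNIV_def)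
    then obtain s u where "s \<in> span (range a)" "z = s + M u" by (auto elim: set_plus_elim)
    moreover then obtain c where "s = (\<Sum>i\<in>UNIV. c i *\<^sub>R a i)" unfolding in_span_range_iff by blast
    ultimately have "border M a ((\<chi> i. - c i), u) = z" by (simp add: border_def sum_negf)
    then show ?thesis by blast
  qed
  then show ?thesis by (rule surj_if_ex)
qed

text \<open>A kernel element \<open>x\<close> and the combination of the \<open>y i\<close> with the
  coordinates of \<open>B x\<close> in the basis \<open>\<delta>\<close> have the same image under
  the injective pair map.\<close>

lemma Ker_eq_span:
  fixes G :: "'v::real_vector \<Rightarrow> 'z::real_vector" and B :: "'v \<Rightarrow> 'u::real_vector"
    and \<delta> :: "'i::finite \<Rightarrow> 'u"
  assumes G: "linear G" and B: "linear B" and inj: "inj (\<lambda>y. (B y, G y))"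
    and \<delta>: "basis_family \<delta>" and y: "\<And>i. B (y i) = \<delta> i" "\<And>i. G (y i) = 0"
  shows "Ker G = span (range y)"
proof
  show "Ker G \<subseteq> span (range y)"
  proof
    fix x assume x: "x \<in> Ker G"
    have "B x \<in> span (range \<delta>)" using \<delta> by (simp add: basis_family_def)
    then obtain c where c: "B x = (\<Sum>i\<in>UNIV. c i *\<^sub>R \<delta> i)" unfolding in_span_range_iff by blast
    have "x = (\<Sum>i\<in>UNIV. c i *\<^sub>R y i)"
      using x by (intro injD[OF inj]) (simp add: c y Ker_def linear_sum[OF B] linear_scale[OF B]
          linear_sum[OF G] linear_scale[OF G])
    then show "x \<in> span (range y)" unfolding in_span_range_iff by blast
  qed
  have "subspace (Ker G)" unfolding Ker_def by (rule linear_subspace_kernel[OF G])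
  then show "span (range y) \<subseteq> Ker G" using y by (intro span_minimal) (auto simp: Ker_def)
qed

text \<open>\<open>B\<close> is injective on \<open>Ker G\<close>, whose dimension is that of the
  target of \<open>B\<close>, so it maps \<open>Ker G\<close> onto that target. Any preimage under
  \<open>G\<close> can therefore be corrected by a kernel element to attain a prescribed value of
  \<open>B\<close>.\<close>

lemma bij_Pair_if_dim_Ker:
  fixes G :: "'v::real_vector \<Rightarrow> 'z::real_vector" and B :: "'v \<Rightarrow> real ^ 'n::finite"
  assumes G: "linear G" and B: "linear B" and surj: "surj G"
    and ker: "Ker G \<inter> Ker B = {0}" and dim: "dim (Ker G) = CARD('n)"
  shows "bij (\<lambda>y. (B y, G y))"
proof (rule bijI)
  show "inj (\<lambda>y. (B y, G y))"
  proof (rule injI)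
    fix x y assume "(B x, G x) = (B y, G y)"
    then have "x - y \<in> Ker G \<inter> Ker B" by (simp add: Ker_def linear_diff[OF G] linear_diff[OF B])
    then show "x = y" using ker by simp
  qed
  have sub: "subspace (Ker G)" unfolding Ker_def by (rule linear_subspace_kernel[OF G])
  obtain b where b: "b \<subseteq> Ker G" "independent b" "Ker G \<subseteq> span b" "card b = dim (Ker G)"
    by (rule basis_exists[of "Ker G"])
  have spb: "span b = Ker G" by (rule subset_antisym[OF span_minimal[OF b(1) sub] b(3)])
  have inj: "inj_on B (span b)"
    unfolding linear_inj_on_iff_eq_0[OF B subspace_span]
  proof (intro ballI impI)
    fix x assume "x \<in> span b" "B x = 0"
    then have "x \<in> Ker G \<inter> Ker B" unfolding spb by (simp add: Ker_def)
    then show "x = 0" unfolding ker by simp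
  qed
  have "independent (B ` b)" by (rule linear_independent_injective_image[OF B b(2) inj])
  moreover have "card (B ` b) = CARD('n)"
    using card_image[OF inj_on_subset[OF inj span_superset]] b(4) dim by simp
  ultimately have "span (B ` b) = UNIV"
    using dim_eq_full[of "B ` b"] by (simp add: dim_eq_card_independent)
  then have B_Ker: "B ` Ker G = UNIV" using spb linear_span_image[OF B, of b] by simp
  have "\<exists>y. (B y, G y) = (r, z)" for r z
  proof -
    obtain y where y: "G y = z" using surj by (metis surjD)
    obtain k where "k \<in> Ker G" "B k = r - B y" using B_Ker by (metis UNIV_I imageE)
    then have "(B (y + k), G (y + k)) = (r, z)"
      using y by (simp add: Ker_def linear_add[OF B] linear_add[OF G])
    then show ?thesis by blast
  qed
  then show "surj (\<lambda>y. (B y, G y))" by (intro surj_if_ex) (simp add: split_paired_all)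
qed

text \<open>\<open>J\<inverse>A\<close> differs from the identity by a map into a finite-dimensional space \<open>E\<close>; it is onto \<open>E\<close>
  because it maps \<open>E\<close> injectively into itself, hence onto.\<close>

lemma surj_finite_rank_perturbation:
  fixes A J :: "'a::real_vector \<Rightarrow> 'b::real_vector"
  assumes A: "linear A" and J: "linear J" and bij: "bij J" and inj: "inj A"
    and fin: "finite_dim (range (\<lambda>x. A x - J x))"
  shows "surj A"
proof -
  obtain S where S: "finite S" "range (\<lambda>x. A x - J x) \<subseteq> span S"
    using fin by (auto simp: finite_dim_def)
  have Jinv: "J (inv J y) = y" and invJ: "inv J (J x) = x" for x y
    using bij by (simp_all add: bij_is_inj bij_is_surj surj_f_inv_f)
  have linv: "linear (inv J)"
  proof (rule linearI)
    show "inv J (x + y) = inv J x + inv J y" for x y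
      using invJ[of "inv J x + inv J y"] by (simp add: linear_add[OF J] Jinv)
    show "inv J (r *\<^sub>R x) = r *\<^sub>R inv J x" for r x
      using invJ[of "r *\<^sub>R inv J x"] by (simp add: linear_scale[OF J] Jinv)
  qed
  define U where "U x = inv J (A x)" for x
  define E where "E = span (inv J ` S)"
  have linU: "linear U" unfolding U_def using linear_compose[OF A linv] by (simp add: o_def)
  have injU: "inj U" unfolding U_def using inj by (metis (mono_tags, lifting) Jinv injD injI)
  have UE: "U x - x \<in> E" for x
  proof -
    have "U x - x = inv J (A x - J x)" by (simp add: U_def linear_diff[OF linv] invJ)
    then show ?thesis using S(2) unfolding E_def linear_span_image[OF linv] by blast
  qed
  obtain b where b: "b \<subseteq> E" "independent b" "E \<subseteq> span b"
    using basis_exists[of E] by metis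
  have fb: "finite b"
    using independent_span_bound[OF _ b(2), of "inv J ` S"] b(1) S(1) by (auto simp: E_def)
  have spb: "span b = E"
    using b span_minimal[OF b(1)] by (auto simp: E_def)
  have ind: "independent (U ` b)"
    using inj_on_subset[OF injU subset_UNIV] by (rule linear_independent_injective_image[OF linU b(2)])
  have card: "card (U ` b) = card b" using injU by (meson card_image inj_on_subset subset_UNIV)
  have sub: "U ` b \<subseteq> E"
  proof clarify
    fix x assume "x \<in> b"
    then have "x + (U x - x) \<in> E"
      unfolding E_def using b(1) UE by (intro span_add) (auto simp: E_def)
    then show "U x \<in> E" by simp
  qed
  have "E \<subseteq> span (U ` b)"
  \<comment> \<open>An element outside would extend the image of \<open>b\<close> to an independent
    set of more than \<open>card b\<close> vectors inside \<open>span b\<close>.\<close>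
  proof (rule subsetI, rule ccontr)
    fix e assume e: "e \<in> E" "e \<notin> span (U ` b)"
    have 1: "independent (insert e (U ` b))" by (rule independent_insertI[OF e(2) ind])
    have 2: "insert e (U ` b) \<subseteq> span b" unfolding spb using e(1) sub by (rule insert_subsetI)
    have "card (insert e (U ` b)) \<le> card b" using independent_span_bound[OF fb 1 2] by (rule conjunct2)
    moreover have "e \<notin> U ` b" using e(2) span_superset[of "U ` b"] by (rule contra_subsetD[rotated])
    ultimately show False using fb card by simp
  qed
  then have EU: "E \<subseteq> U ` E" using spb linear_span_image[OF linU, of b] by simp
  have "\<exists>x. A x = y" for y
  proof -
    let ?v = "inv J y"
    \<comment> \<open>The defect \<open>U ?v - ?v\<close> lies in \<open>E\<close>, hence is itself
      some \<open>U e\<close>; subtracting \<open>e\<close> from \<open>?v\<close> removes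
      it.\<close>
    obtain e where "U e = U ?v - ?v" using subsetD[OF EU UE[of ?v]] by (metis imageE)
    then have "U (?v - e) = ?v" by (simp add: linear_diff[OF linU])
    then have "A (?v - e) = y" using Jinv[of "A (?v - e)"] Jinv[of y] by (simp add: U_def)
    then show ?thesis by blast
  qed
  then show ?thesis by (rule surj_if_ex)
qed

text \<open>The two pair maps have different domains, so finite-dimensional identity factors are
  added: \<open>A\<close> is the first map times the identity of \<open>real ^ 'n\<close>, and
  \<open>J\<close> is the second map times the identification \<open>join\<close>. Both contain the
  same term \<open>L (0, w)\<close>, which leaves a difference of finite rank.\<close>

lemma surj_extended_if_inj:
  fixes L :: "(real ^ 'm::finite) \<times> 'w::real_vector \<Rightarrow> 'z::real_vector"
    and a :: "'q::finite \<Rightarrow> 'z" and b :: "'n::finite \<Rightarrow> 'z"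
    and B :: "(real ^ 'q) \<times> (real ^ 'm) \<times> 'w \<Rightarrow> real ^ ('q + 'm)"
    and Bb :: "(real ^ 'n) \<times> 'w \<Rightarrow> real ^ 'n"
  assumes L: "linear L" and B: "linear B" and Bb: "linear Bb"
    and bij: "bij (\<lambda>z. (Bb z, border (\<lambda>v. L (0, v)) b z))"
    and inj: "inj (\<lambda>x. (B x, border L a x))"
  shows "surj (\<lambda>x. (B x, border L a x))"
proof -
  define join :: "real ^ 'q \<Rightarrow> real ^ 'm \<Rightarrow> real ^ ('q + 'm)"
    where "join g l = (\<chi> i. case i of Inl j \<Rightarrow> g $ j | Inr j \<Rightarrow> l $ j)" for g l
  have join_add: "join (g + g') (l + l') = join g l + join g' l'" for g g' l l'
    by (simp add: join_def vec_eq_iff split: sum.split)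
  have join_scale: "join (r *\<^sub>R g) (r *\<^sub>R l) = r *\<^sub>R join g l" for r g l
    by (simp add: join_def vec_eq_iff split: sum.split)
  have join_eq: "join g l = join g' l' \<longleftrightarrow> g = g' \<and> l = l'" for g g' l l'
    by (auto simp: join_def vec_eq_iff split: sum.splits)
  have join_surj: "\<exists>g l. r = join g l" for r
    by (intro exI[of _ "\<chi> j. r $ Inl j"] exI[of _ "\<chi> j. r $ Inr j"])
      (simp add: join_def vec_eq_iff split: sum.split)
  let ?G = "border L a" and ?H = "border (\<lambda>v. L (0, v)) b"
  have linT: "linear (\<lambda>v. L (0, v))"
    using linear_compose[OF _ L, of "\<lambda>v. (0, v)"] by (simp add: o_def linear_iff)
  have linG: "linear ?G" and linH: "linear ?H" using L linT by (simp_all add: linear_border)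
  have add: "B (g + g', l + l', w + w') = B (g, l, w) + B (g', l', w')"
      "?G (g + g', l + l', w + w') = ?G (g, l, w) + ?G (g', l', w')"
      "Bb (e + e', w + w') = Bb (e, w) + Bb (e', w')"
      "?H (e + e', w + w') = ?H (e, w) + ?H (e', w')" for g g' l l' w w' e e'
    using linear_add[OF B, of "(g, l, w)" "(g', l', w')"] linear_add[OF linG, of "(g, l, w)" "(g', l', w')"]
      linear_add[OF Bb, of "(e, w)" "(e', w')"] linear_add[OF linH, of "(e, w)" "(e', w')"] by simp_all
  have scale: "B (r *\<^sub>R g, r *\<^sub>R l, r *\<^sub>R w) = r *\<^sub>R B (g, l, w)"
      "?G (r *\<^sub>R g, r *\<^sub>R l, r *\<^sub>R w) = r *\<^sub>R ?G (g, l, w)"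
      "Bb (r *\<^sub>R e, r *\<^sub>R w) = r *\<^sub>R Bb (e, w)"
      "?H (r *\<^sub>R e, r *\<^sub>R w) = r *\<^sub>R ?H (e, w)" for r g l w e
    using linear_scale[OF B, of r "(g, l, w)"] linear_scale[OF linG, of r "(g, l, w)"]
      linear_scale[OF Bb, of r "(e, w)"] linear_scale[OF linH, of r "(e, w)"] by simp_all
  define A where "A = (\<lambda>((g, l, w), e). ((B (g, l, w), ?G (g, l, w)), e :: real ^ 'n))"
  define J where "J = (\<lambda>((g, l, w), e). ((join g l, ?H (e, w)), Bb (e, w)))"
  \<comment> \<open>\<open>A - J\<close> takes its values in the range of \<open>P\<close>, whose
    domain is finite-dimensional: \<open>L (l, w) - L (0, w) = L (l, 0)\<close> is free of
    \<open>w\<close>, and \<open>B\<close> and \<open>Bb\<close> enter only through the vectors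
    \<open>\<alpha>\<close> and \<open>\<beta>\<close>.\<close>
  define P where "P = (\<lambda>(\<alpha>, \<beta>, l, g, e).
    ((\<alpha> :: real ^ ('q + 'm), L (l, 0) - (\<Sum>i\<in>UNIV. g $ i *\<^sub>R a i) + (\<Sum>k\<in>UNIV. e $ k *\<^sub>R b k)), \<beta> :: real ^ 'n))"
  have "surj A"
  proof (rule surj_finite_rank_perturbation)
    show "linear A"
      unfolding linear_iff A_def
      by (simp add: split_paired_all add scale)
    show "linear J"
      unfolding linear_iff J_def
      by (simp add: split_paired_all join_add join_scale add scale)
    show "bij J"
    proof (rule bijI)
      show "inj J"
        using bij_is_inj[OF bij] by (auto simp: inj_def J_def join_eq)
      have "\<exists>x. J x = ((r, z), s)" for r z s
      proof -
        obtain g l where "r = join g l" using join_surj by blast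
        moreover obtain p where "(s, z) = (Bb p, ?H p)"
          using surjD[OF bij_is_surj[OF bij], of "(s, z)"] by blast
        ultimately have "J ((g, l, snd p), fst p) = ((r, z), s)" by (simp add: J_def)
        then show ?thesis by blast
      qed
      then show "surj J" by (intro surj_if_ex) (simp add: split_paired_all)
    qed
    show "inj A" using inj by (auto simp: inj_def A_def)
    have L1: "L (l + l', 0) = L (l, 0) + L (l', 0)" "L (r *\<^sub>R l, 0) = r *\<^sub>R L (l, 0)" for l l' r
      using linear_add[OF L, of "(l, 0)" "(l', 0)"] linear_scale[OF L, of r "(l, 0)"] by simp_all
    have linP: "linear P"
      unfolding linear_iff P_def
      by (simp add: split_beta L1 scaleR_add_left sum.distrib scaleR_sum_right scaleR_add_right
          scaleR_diff_right)
    have "A x - J x \<in> range P" for x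
    proof -
      obtain g l w e where x: "x = ((g, l, w), e)" by (metis surj_pair)
      have "A x - J x = P (B (g, l, w) - join g l, e - Bb (e, w), l, g, e)"
        using linear_diff[OF L, of "(l, w)" "(0, w)"]
        by (simp add: x A_def J_def P_def border_def)
      then show ?thesis by blast
    qed
    then have "range (\<lambda>x. A x - J x) \<subseteq> range P" by blast
    also have "range P = span (P ` Basis)"
      using linear_span_image[OF linP, of Basis] by simp
    finally show "finite_dim (range (\<lambda>x. A x - J x))"
      unfolding finite_dim_def by (intro exI[of _ "P ` Basis"]) auto
  qed
  then have "\<exists>x. (B x, ?G x) = y" for y
    using surjD[of A "(y, 0)"] by (force simp: A_def)
  then show ?thesis by (rule surj_if_ex)
qed

text \<open>Forward substitution: the first row determines \<open>x\<close>, after which the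
  coupling terms are known and every other row is an equation for \<open>A\<close> or
  \<open>C\<close> alone. Conversely, \<open>C\<close> is recovered on the slice
  \<open>x = 0\<close>, where the coupling vanishes.\<close>

lemma bij_block_triangular:
  fixes A :: "'x::real_vector \<Rightarrow> 'y::real_vector" and C :: "'u::real_vector \<Rightarrow> 'v::real_vector"
    and K :: "'i::finite \<Rightarrow> 'x \<Rightarrow> 'y" and M :: "'k::finite \<Rightarrow> 'x \<Rightarrow> 'v"
  assumes A: "linear A" "bij A" and C: "linear C" and K: "\<And>i. K i 0 = 0" and M: "\<And>k. M k 0 = 0"
  shows "bij (\<lambda>(x, ys, zs). (A x, (\<chi> i. A (ys $ i) + K i x), (\<chi> k. C (zs $ k) + M k x))) \<longleftrightarrow> bij C"
    (is "bij ?S \<longleftrightarrow> _")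
proof
  have injA: "A x = A x' \<longleftrightarrow> x = x'" for x x' using A(2) by (simp add: bij_is_inj inj_eq)
  have A0: "A x = 0 \<longleftrightarrow> x = 0" for x using injA[of x 0] linear_0[OF A(1)] by simp
  {
    assume S: "bij ?S"
    show "bij C"
    proof (rule bijI)
      show "inj C"
      proof (rule injI)
        fix z z' assume "C z = C z'"
        then have "?S (0, 0, \<chi> k. z) = ?S (0, 0, \<chi> k. z')" by simp
        then have "(\<chi> k. z) = (\<chi> k::'k. z')" using injD[OF bij_is_inj[OF S]] by blast
        then show "z = z'" by (simp add: vec_eq_iff)
      qed
      have "\<exists>z. C z = v" for v
      proof -
        \<comment> \<open>The zero first component forces \<open>x = 0\<close>, so the terms
          \<open>M k x\<close> vanish and any row yields a preimage of \<open>v\<close>.\<close>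
        obtain s where "(0, 0, \<chi> k. v) = ?S s"
          using surjD[OF bij_is_surj[OF S], of "(0, 0, \<chi> k. v)"] by blast
        moreover obtain x ys zs where "s = (x, ys, zs)" by (cases s)
        ultimately have "A x = 0" "\<forall>k. C (zs $ k) + M k x = v" by (auto simp: vec_eq_iff)
        then show ?thesis using A0 M by auto
      qed
      then show "surj C" by (rule surj_if_ex)
    qed
  next
    assume C: "bij C"
    have injC: "C x = C x' \<longleftrightarrow> x = x'" for x x' using C by (simp add: bij_is_inj inj_eq)
    show "bij ?S"
    proof (rule bijI)
      show "inj ?S" by (auto simp: inj_def injA injC vec_eq_iff)
      have "\<exists>s. ?S s = (x, ys, zs)" for x ys zs
      proof -
        let ?x = "inv A x"
        have "A (inv A y) = y" "C (inv C z) = z" for y z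
          using A(2) C by (simp_all add: bij_is_surj surj_f_inv_f)
        then have "?S (?x, (\<chi> i. inv A (ys $ i - K i ?x)), (\<chi> k. inv C (zs $ k - M k ?x))) = (x, ys, zs)"
          by (simp add: vec_eq_iff)
        then show ?thesis by blast
      qed
      then show "surj ?S" by (intro surj_if_ex) (simp add: split_paired_all)
    qed
  }
qed

text \<open>The \<open>y i\<close> span the kernel of \<open>border M a\<close>, so every kernel
  element inherits their vanishing first component, and the criterion for direct sums applies. It
  serves for both DF and D_uF.\<close>

lemma direct_sum_if_regular_extension:
  fixes M :: "'u::real_normed_vector \<Rightarrow> 'z::real_normed_vector" and a :: "'k::finite \<Rightarrow> 'z"
    and B :: "(real ^ 'k) \<times> 'u \<Rightarrow> 'b::real_normed_vector" and \<delta> :: "'i::finite \<Rightarrow> 'b"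
  assumes M: "linear M" and B: "linear B" and bij: "bij (\<lambda>x. (B x, border M a x))"
    and \<delta>: "basis_family \<delta>" and y: "\<And>i. B (y i) = \<delta> i" "\<And>i. border M a (y i) = 0"
    and fst_y: "\<And>i. fst (y i) = 0"
  shows "lin_indep_family a" "direct_sum_UNIV (span (range a)) (range M)"
    and "Ker (border M a) = {(g, u). g = 0 \<and> u \<in> Ker M}"
    and "Ker (border M a) \<inter> Ker B = {0}"
proof -
  have linG: "linear (border M a)" by (rule linear_border[OF M])
  have "Ker (border M a) = span (range y)"
    by (rule Ker_eq_span[OF linG B bij_is_inj[OF bij] \<delta> y])
  also have "\<dots> \<subseteq> {x. fst x = 0}"
    using fst_y by (intro span_minimal) (auto simp: subspace_def)
  finally have ker: "fst x = 0" if "border M a x = 0" for x using that by (auto simp: Ker_def)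
  have surj: "surj (border M a)"
  proof (rule surj_if_ex)
    fix z show "\<exists>x. border M a x = z"
      using surjD[OF bij_is_surj[OF bij], of "(0, z)"] by auto
  qed
  show "lin_indep_family a" "direct_sum_UNIV (span (range a)) (range M)"
    using direct_sum_if_border_surj[OF M surj ker] by auto
  show "Ker (border M a) = {(g, u). g = 0 \<and> u \<in> Ker M}"
    by (rule Ker_border[OF ker])
  have "x = 0" if "border M a x = 0" "B x = 0" for x
    using that linear_0[OF B] linear_0[OF linG] by (intro injD[OF bij_is_inj[OF bij]]) simp
  then show "Ker (border M a) \<inter> Ker B = {0}"
    using linear_0[OF B] linear_0[OF linG] by (auto simp: Ker_def)
qed

text \<open>The range of \<open>M\<close> is the preimage of \<open>{0}\<close> under the continuous map \<open>z \<mapsto> fst (inv C (0, z))\<close>.\<close>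

lemma closed_range_if_regular_extension:
  fixes M :: "'u::real_normed_vector \<Rightarrow> 'z::real_normed_vector" and a :: "'k::finite \<Rightarrow> 'z"
    and B :: "(real ^ 'k) \<times> 'u \<Rightarrow> 'b::real_normed_vector" and \<delta> :: "'i::finite \<Rightarrow> 'b"
  assumes M: "linear M" and B: "linear B" and iso: "isomorphism (\<lambda>x. (B x, border M a x))"
    and \<delta>: "basis_family \<delta>" and y: "\<And>i. B (y i) = \<delta> i" "\<And>i. border M a (y i) = 0"
    and fst_y: "\<And>i. fst (y i) = 0"
  shows "closed (range M)"
proof -
  let ?C = "\<lambda>x. (B x, border M a x)"
  have bij: "bij ?C" and cont: "continuous_on UNIV (inv ?C)"
    using iso by (simp_all add: isomorphism_def)
  have linG: "linear (border M a)" by (rule linear_border[OF M])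
  have "range M = (\<lambda>z. fst (inv ?C (0, z))) -` {0}"
  proof (intro subset_antisym subsetI)
    fix z assume "z \<in> range M"
    then obtain u where u: "z = M u" by blast
    have "B (0, u) \<in> span (range \<delta>)" using \<delta> by (simp add: basis_family_def)
    then obtain c where c: "B (0, u) = (\<Sum>i\<in>UNIV. c i *\<^sub>R \<delta> i)" unfolding in_span_range_iff by blast
    \<comment> \<open>The subtracted combination cancels the value of \<open>B\<close> and changes
      neither the value of \<open>border M a\<close> nor the first component.\<close>
    let ?x = "(0, u) - (\<Sum>i\<in>UNIV. c i *\<^sub>R y i)"
    have "?C ?x = (0, z)"
      by (simp add: linear_diff[OF B] linear_diff[OF linG] linear_sum[OF B] linear_sum[OF linG]
          linear_scale[OF B] linear_scale[OF linG] c y u) (simp add: border_def)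
    then have "inv ?C (0, z) = ?x" by (rule inv_f_eq[OF bij_is_inj[OF bij]])
    then show "z \<in> (\<lambda>z. fst (inv ?C (0, z))) -` {0}" by (simp add: fst_sum fst_y)
  next
    fix z assume z: "z \<in> (\<lambda>z. fst (inv ?C (0, z))) -` {0}"
    obtain g u where gu: "inv ?C (0, z) = (g, u)" by (metis surj_pair)
    have "?C (g, u) = (0, z)" unfolding gu[symmetric] by (rule surj_f_inv_f[OF bij_is_surj[OF bij]])
    then show "z \<in> range M" using z gu by (auto simp: border_def)
  qed
  moreover have "continuous_on UNIV (\<lambda>z. fst (inv ?C (0, z)))"
    by (intro continuous_on_fst continuous_on_compose2[OF cont] continuous_intros) auto
  ultimately show ?thesis by (simp add: closed_vimage_Int continuous_on_closed_vimage)
qed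

section \<open>Derivatives\<close>

text \<open>\<open>S\<close> contains first derivatives of F, so its derivative needs second ones.
  The estimates in \<open>class_C\<close> are uniform in the list of vectors, which is what
  differentiability of the \<open>blinfun\<close>-valued first derivative in operator norm
  requires.\<close>

lemma class_C_imp_second_derivative:
  fixes f :: "'a::real_normed_vector \<Rightarrow> 'b::real_normed_vector"
  assumes f: "class_C p f" and p: "p \<ge> 2"
  obtains f' f'' where "\<And>x. (f has_derivative blinfun_apply (f' x)) (at x)"
    and "\<And>x. (f' has_derivative f'' x) (at x)"
proof -
  from f obtain D :: "nat \<Rightarrow> 'a \<Rightarrow> 'a list \<Rightarrow> 'b" where
      D0: "\<And>x. D 0 x [] = f x"
    and ml: "\<And>k x. k \<le> p \<Longrightarrow> bounded_multilinear k (D k x)"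
    and der: "\<And>k x \<epsilon>. k < p \<Longrightarrow> \<epsilon> > 0 \<Longrightarrow> \<forall>\<^sub>F y in nhds x. \<forall>vs. length vs = k \<longrightarrow>
           norm (D k y vs - D k x vs - D (Suc k) x ((y - x) # vs))
             \<le> \<epsilon> * norm (y - x) * prod_list (map norm vs)"
    unfolding class_C_def by (elim exE conjE) (rule that; iprover)
  have lin1: "bounded_linear (\<lambda>v. D 1 x [v])" for x
  proof -
    have m: "bounded_multilinear 1 (D 1 x)" using ml p by simp
    \<comment> \<open>The entry \<open>undefined\<close> is a placeholder that the update replaces
      by \<open>v\<close>.\<close>
    then have "linear (\<lambda>v. D 1 x ([undefined][0 := v]))"
      unfolding bounded_multilinear_def by (metis length_Cons list.size(3) One_nat_def less_one)
    moreover obtain K where "\<And>vs. length vs = 1 \<Longrightarrow> norm (D 1 x vs) \<le> K * prod_list (map norm vs)"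
      using m unfolding bounded_multilinear_def by blast
    from this[of "[_]"] have "norm (D 1 x [v]) \<le> norm v * K" for v by (simp add: mult.commute)
    ultimately show ?thesis
      by (auto simp: bounded_linear_def bounded_linear_axioms_def)
  qed
  have lin2: "bounded_bilinear (\<lambda>v w. D 2 x [v, w])" for x
  proof -
    have m: "bounded_multilinear 2 (D 2 x)" using ml p by simp
    then have lin: "linear (\<lambda>v. D 2 x (vs[i := v]))" if "length vs = 2" "i < 2" for vs i
      using that unfolding bounded_multilinear_def by blast
    have "linear (\<lambda>v. D 2 x [v, w])" for w
      using lin[of "[undefined, w]" 0] by simp
    moreover have "linear (\<lambda>w. D 2 x [v, w])" for v
      using lin[of "[v, undefined]" 1] by simp
    moreover obtain K where "\<And>vs. length vs = 2 \<Longrightarrow> norm (D 2 x vs) \<le> K * prod_list (map norm vs)"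
      using m unfolding bounded_multilinear_def by blast
    from this[of "[_, _]"] have "norm (D 2 x [v, w]) \<le> norm v * norm w * K" for v w
      by (simp add: mult.commute)
    ultimately show ?thesis
      by (auto simp: bounded_bilinear_def linear_iff)
  qed
  define f' where "f' x = Blinfun (\<lambda>v. D 1 x [v])" for x
  define f'' where "f'' x = (\<lambda>v. Blinfun (\<lambda>w. D 2 x [v, w]))" for x
  have f': "blinfun_apply (f' x) v = D 1 x [v]" for x v
    unfolding f'_def bounded_linear_Blinfun_apply[OF lin1] by (rule refl)
  have f'': "blinfun_apply (f'' x v) w = D 2 x [v, w]" for x v w
    unfolding f''_def bounded_linear_Blinfun_apply[OF bounded_bilinear.bounded_linear_right[OF lin2]] by (rule refl)
  have 1: "(f has_derivative blinfun_apply (f' x)) (at x)" for x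
    unfolding has_derivative_within_alt2
  proof (intro conjI allI impI)
    fix \<epsilon> :: real assume "\<epsilon> > 0"
    \<comment> \<open>For order 0 the only list is empty and its product is 1, so the estimate is
      ordinary differentiability of \<open>f\<close>.\<close>
    from der[OF _ this, of 0 x] p
    have "\<forall>\<^sub>F y in nhds x. norm (f y - f x - blinfun_apply (f' x) (y - x)) \<le> \<epsilon> * norm (y - x)"
      by (simp add: D0 f')
    then show "\<forall>\<^sub>F y in at x. norm (f y - f x - blinfun_apply (f' x) (y - x)) \<le> \<epsilon> * norm (y - x)"
      by (simp add: eventually_at_filter eventually_mono)
  qed (rule blinfun.bounded_linear_right)
  have 2: "(f' has_derivative f'' x) (at x)" for x
    unfolding has_derivative_within_alt2
  proof (intro conjI allI impI)
    obtain K where K: "K \<ge> 0" "\<And>v w. norm (D 2 x [v, w]) \<le> norm v * norm w * K"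
      using bounded_bilinear.nonneg_bounded[OF lin2] by blast
    have K': "norm (D 2 x [v, w]) \<le> norm v * K * norm w" for v w
      using K(2)[of v w] by (simp add: mult.assoc mult.commute[of K])
    show "bounded_linear (f'' x)"
    proof (rule bounded_linear_intro[where K = K])
      show "norm (f'' x v) \<le> norm v * K" for v
        using K(1) K' by (intro norm_blinfun_bound) (simp_all add: f'')
    qed (auto intro!: blinfun_eqI simp: f'' blinfun.add_left blinfun.scaleR_left
        bounded_bilinear.add_left[OF lin2] bounded_bilinear.scaleR_left[OF lin2])
    fix \<epsilon> :: real assume \<epsilon>: "\<epsilon> > 0"
    have "\<forall>\<^sub>F y in nhds x. \<forall>vs. length vs = 1 \<longrightarrow>
       norm (D 1 y vs - D 1 x vs - D 2 x ((y - x) # vs)) \<le> \<epsilon> * norm (y - x) * prod_list (map norm vs)"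
      using der[OF _ \<epsilon>, of 1 x] p by (simp add: numeral_2_eq_2)
    then have "\<forall>\<^sub>F y in nhds x. norm (f' y - f' x - f'' x (y - x)) \<le> \<epsilon> * norm (y - x)"
    proof eventually_elim
      case (elim y)
      show ?case
      proof (rule norm_blinfun_bound)
        fix v
        show "norm (blinfun_apply (f' y - f' x - f'' x (y - x)) v) \<le> \<epsilon> * norm (y - x) * norm v"
          using elim[rule_format, of "[v]"] by (simp add: f' f'' blinfun.diff_left del: One_nat_def)
      qed (use \<epsilon> in simp)
    qed
    then show "\<forall>\<^sub>F y in at x. norm (f' y - f' x - f'' x (y - x)) \<le> \<epsilon> * norm (y - x)"
      by (simp add: eventually_at_filter eventually_mono)
  qed
  show thesis by (rule that[OF 1 2])
qed

text \<open>A vector is the sum of its components under the bounded linear maps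
  \<open>axis i\<close>, so the sum rule applies.\<close>

lemma has_derivative_vec_lambda [derivative_intros]:
  fixes f :: "'i::finite \<Rightarrow> 'a::real_normed_vector \<Rightarrow> 'b::real_normed_vector"
  assumes "\<And>i. (f i has_derivative f' i) F"
  shows "((\<lambda>x. \<chi> i. f i x) has_derivative (\<lambda>h. \<chi> i. f' i h)) F"
proof -
  have axis: "bounded_linear (axis i :: 'b \<Rightarrow> 'b ^ 'i)" for i
  proof (rule bounded_linear_intro[where K = 1])
    fix v :: 'b
    have "norm (axis i v) \<le> (\<Sum>j\<in>UNIV. norm (axis i v $ j))"
      unfolding norm_vec_def by (rule L2_set_le_sum) simp
    also have "\<dots> = (\<Sum>j\<in>UNIV. if j = i then norm v else 0)"
      by (rule sum.cong) (auto simp: axis_def)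
    finally show "norm (axis i v) \<le> norm v * 1" by simp
  qed (auto simp: axis_def vec_eq_iff)
  have eq: "(\<chi> i. g i) = (\<Sum>i\<in>UNIV. axis i (g i))" for g :: "'i \<Rightarrow> 'b"
    by (simp add: vec_eq_iff axis_def)
  show ?thesis
    unfolding eq by (intro has_derivative_sum bounded_linear.has_derivative[OF axis] assms)
qed

lemma vec_lambda_diff_eq_0_iff:
  fixes f g :: "'i::finite \<Rightarrow> 'a::ab_group_add"
  shows "(\<chi> i. f i - g i) = 0 \<longleftrightarrow> (\<forall>i. f i = g i)"
  by (simp add: vec_eq_iff)

lemma border_has_derivative:
  fixes a :: "'k::finite \<Rightarrow> 'z::real_normed_vector"
  assumes "(F has_derivative F') (at (snd x))"
  shows "(border F a has_derivative border F' a) (at x)"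
proof -
  have "((\<lambda>x. F (snd x) - (\<Sum>i\<in>UNIV. fst x $ i *\<^sub>R a i)) has_derivative
      (\<lambda>h. F' (snd h) - (\<Sum>i\<in>UNIV. fst h $ i *\<^sub>R a i))) (at x)"
    by (intro has_derivative_diff has_derivative_sum has_derivative_scaleR_left
        bounded_linear.has_derivative[OF bounded_linear_vec_nth] has_derivative_fst
        has_derivative_compose[where f = snd, OF _ assms] has_derivative_snd has_derivative_ident)
  then show ?thesis by (simp add: border_def split_beta')
qed

text \<open>The product rule for evaluating the operator \<open>P s\<close> leaves an extra term
  with \<open>P'\<close>, the source of the coupling in the derivative of \<open>S\<close>. The map
  \<open>j\<close> is the identity in the rows of \<open>Phi_G\<close> and
  \<open>\<lambda>v. (0, v)\<close> in those of \<open>Phi_H\<close>.\<close>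

lemma border_apply_has_derivative:
  fixes b :: "'k::finite \<Rightarrow> 'z::real_normed_vector"
    and P :: "'s::real_normed_vector \<Rightarrow> 'u::real_normed_vector \<Rightarrow>\<^sub>L 'z" and z :: "'s \<Rightarrow> (real ^ 'k) \<times> 'w::real_normed_vector"
  assumes P: "(P has_derivative P') (at s)" and z: "(z has_derivative z') (at s)" and j: "bounded_linear j"
  shows "((\<lambda>s. border (\<lambda>v. P s (j v)) b (z s)) has_derivative
      (\<lambda>h. border (\<lambda>v. P s (j v)) b (z' h) + P' h (j (snd (z s))))) (at s)"
proof -
  have "((\<lambda>s. P s (j (snd (z s))) - (\<Sum>i\<in>UNIV. fst (z s) $ i *\<^sub>R b i)) has_derivative
      (\<lambda>h. (P s (j (snd (z' h))) + P' h (j (snd (z s)))) - (\<Sum>i\<in>UNIV. fst (z' h) $ i *\<^sub>R b i))) (at s)"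
    by (intro has_derivative_diff has_derivative_sum has_derivative_scaleR_left
        bounded_bilinear.FDERIV[OF bounded_bilinear_blinfun_apply P]
        bounded_linear.has_derivative[OF bounded_linear_vec_nth] has_derivative_fst
        bounded_linear.has_derivative[OF j] has_derivative_snd z)
  then show ?thesis by (simp add: border_def split_beta' algebra_simps)
qed

lemma G_map_eq_border: "G_map F a = border F a"
  by (auto simp: G_map_def border_def fun_eq_iff)

lemma H_map_eq_border: "H_map F b l u = border (D_u F l u) b"
  by (auto simp: H_map_def border_def fun_eq_iff)

lemma Dif_eq: "(f has_derivative f') (at x) \<Longrightarrow> Dif f x = f'"
  by (rule frechet_derivative_at[symmetric])

lemma D_u_eq:
  fixes F :: "(real ^ 'm::finite) \<times> 'w::real_normed_vector \<Rightarrow> 'z::real_normed_vector"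
  assumes "(F has_derivative F') (at (l, u))"
  shows "D_u F l u = (\<lambda>v. F' (0, v))"
proof -
  have "((\<lambda>v. (l, v)) has_derivative (\<lambda>h. (0, h))) (at u)"
    by (intro has_derivative_Pair has_derivative_const has_derivative_ident)
  from has_derivative_compose[OF this assms] show ?thesis
    unfolding D_u_def by (rule Dif_eq)
qed

text \<open>The derivative is arranged in the shape of \<open>bij_block_triangular\<close>: a
  diagonal block in each row plus a coupling term through \<open>F''\<close> whose only variable is
  \<open>x'\<close>.\<close>

lemma S_map_has_derivative:
  fixes F :: "(real ^ 'm::finite) \<times> 'w::real_normed_vector \<Rightarrow> 'z::real_normed_vector"
    and a :: "'q::finite \<Rightarrow> 'z" and b :: "'n::finite \<Rightarrow> 'z"
    and B :: "('q, 'm, 'w) X_space \<Rightarrow> real ^ ('q + 'm)" and Bb :: "('n, 'w) Delta_space \<Rightarrow> real ^ 'n"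
    and x :: "('q, 'm, 'w) X_space"
  assumes F: "\<And>p. (F has_derivative blinfun_apply (F' p)) (at p)"
    and F': "\<And>p. (F' has_derivative F'' p) (at p)"
    and B: "bounded_linear B" and Bb: "bounded_linear Bb"
  shows "(S_map F a b B Bb \<theta> \<delta> \<delta>' has_derivative
     (\<lambda>(x', ys', zs').
       ((B x', border (F' (snd x)) a x'),
        (\<chi> i. (B (ys' $ i), border (F' (snd x)) a (ys' $ i)) +
          (0, F'' (snd x) (snd x') (snd (ys $ i)))),
        (\<chi> k. (Bb (zs' $ k), border (\<lambda>v. F' (snd x) (0, v)) b (zs' $ k)) +
          (0, F'' (snd x) (snd x') (0, snd (zs $ k)))))))
     (at (x, ys, zs))"
proof -
  \<comment> \<open>\<open>Phi_G\<close> uses the derivative of G at a moving point, so its formula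
    is needed at every \<open>x\<close> before \<open>S\<close> is differentiated.\<close>
  have dG: "Dif (border F a) x = border (F' (snd x)) a" for x
    by (intro Dif_eq border_has_derivative F)
  have S: "S_map F a b B Bb \<theta> \<delta> \<delta>' = (\<lambda>s.
      ((B (fst s) - \<theta>, border F a (fst s)),
       (\<chi> i. (B (fst (snd s) $ i) - \<delta> i, border (\<lambda>v. F' (snd (fst s)) v) a (fst (snd s) $ i))),
       (\<chi> k. (Bb (snd (snd s) $ k) - \<delta>' k, border (\<lambda>v. F' (snd (fst s)) (0, v)) b (snd (snd s) $ k)))))"
    by (auto simp: fun_eq_iff S_map_def Psi_map_def Phi_G_def Phi_H_def G_map_eq_border dG
        H_map_eq_border D_u_eq[OF F] vec_eq_iff)
  have P: "((\<lambda>s. F' (snd (fst s))) has_derivative (\<lambda>h. F'' (snd x) (snd (fst h)))) (at (x, ys, zs))"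
    by (rule has_derivative_compose[OF _ F', of "\<lambda>s. snd (fst s)" _ "(x, ys, zs)", simplified])
      (intro has_derivative_snd has_derivative_fst has_derivative_ident)
  have G: "((\<lambda>s. border F a (fst s)) has_derivative (\<lambda>h. border (F' (snd x)) a (fst h))) (at (x, ys, zs))"
    by (rule has_derivative_compose[where f = fst, OF _ border_has_derivative])
      (auto intro: F has_derivative_fst has_derivative_ident)
  have j: "bounded_linear (\<lambda>v::'w. (0 :: real ^ 'm, v))"
    by (intro bounded_linear_Pair bounded_linear_zero bounded_linear_ident)
  have Y: "((\<lambda>s. fst (snd s) $ i) has_derivative (\<lambda>h. fst (snd h) $ i)) (at (x, ys, zs))" for i
    by (intro bounded_linear.has_derivative[OF bounded_linear_vec_nth] has_derivative_fst
        has_derivative_snd has_derivative_ident)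
  have Z: "((\<lambda>s. snd (snd s) $ k) has_derivative (\<lambda>h. snd (snd h) $ k)) (at (x, ys, zs))" for k
    by (intro bounded_linear.has_derivative[OF bounded_linear_vec_nth]
        has_derivative_snd has_derivative_ident)
  note dY = border_apply_has_derivative[OF P Y bounded_linear_ident, where b = a]
  note dZ = border_apply_has_derivative[OF P Z j, where b = b]
  have "(S_map F a b B Bb \<theta> \<delta> \<delta>' has_derivative
     (\<lambda>h. ((B (fst h) - 0, border (F' (snd x)) a (fst h)),
        (\<chi> i. (B (fst (snd h) $ i) - 0, border (F' (snd x)) a (fst (snd h) $ i)
          + F'' (snd x) (snd (fst h)) (snd (ys $ i)))),
        (\<chi> k. (Bb (snd (snd h) $ k) - 0, border (\<lambda>v. F' (snd x) (0, v)) b (snd (snd h) $ k)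
          + F'' (snd x) (snd (fst h)) (0, snd (zs $ k)))))))
     (at (x, ys, zs))"
    unfolding S
    by (intro has_derivative_Pair has_derivative_vec_lambda has_derivative_diff has_derivative_const
        bounded_linear.has_derivative[OF B] bounded_linear.has_derivative[OF Bb]
        has_derivative_fst has_derivative_ident G Y Z dY[simplified] dZ[simplified])
  then show ?thesis by (simp add: split_beta')
qed

section \<open>The equivalence\<close>

theorem theorem3p5:
  fixes F :: "(real ^ 'm::finite) \<times> 'w::banach \<Rightarrow> 'z::banach"
    and p :: nat
    and a :: "'q::finite \<Rightarrow> 'z"
    and b :: "'n::finite \<Rightarrow> 'z"
    and B :: "('q, 'm, 'w) X_space \<Rightarrow> real ^ ('q + 'm)"
    and Bb :: "('n, 'w) Delta_space \<Rightarrow> real ^ 'n"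
    and l\<^sub>0 :: "real ^ 'm" and u\<^sub>0 :: 'w
    and x\<^sub>0 :: "('q, 'm, 'w) X_space"
    and \<theta>\<^sub>0 :: "real ^ ('q + 'm)"
    and \<delta> :: "'q + 'm \<Rightarrow> real ^ ('q + 'm)"
    and \<delta>' :: "'n \<Rightarrow> real ^ 'n"
  assumes dims: "finite_dim (UNIV :: 'w set) \<longleftrightarrow> finite_dim (UNIV :: 'z set)"
    and p: "p \<ge> 2"
    and F: "class_C p F"
    and a: "\<And>i. a i \<noteq> 0"
    and b: "\<And>k. b k \<noteq> 0"
    and B: "bounded_linear B" "\<And>j. \<exists>x. B x $ j \<noteq> 0"
    and Bb: "bounded_linear Bb" "\<And>k. \<exists>z. Bb z $ k \<noteq> 0"
    and x0: "x\<^sub>0 = (0, l\<^sub>0, u\<^sub>0)"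
    and \<delta>: "basis_family \<delta>"
    and \<delta>': "basis_family \<delta>'"
  shows
    "(F (l\<^sub>0, u\<^sub>0) = 0 \<and>
      fredholm (D_u F l\<^sub>0 u\<^sub>0) \<and> fredholm_index (D_u F l\<^sub>0 u\<^sub>0) = 0 \<and>
      CARD('n) = dim (Ker (D_u F l\<^sub>0 u\<^sub>0)) \<and>
      finite_codim (range (Dif F (l\<^sub>0, u\<^sub>0))) \<and>
      CARD('q) = codim (range (Dif F (l\<^sub>0, u\<^sub>0))) \<and>
      lin_indep_family a \<and>
      direct_sum_UNIV (span (range a)) (range (Dif F (l\<^sub>0, u\<^sub>0))) \<and>
      lin_indep_family b \<and>
      direct_sum_UNIV (span (range b)) (range (D_u F l\<^sub>0 u\<^sub>0)) \<and>
      unique_solution_at (G_map F a) x\<^sub>0 \<and>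
      Ker (Dif (G_map F a) x\<^sub>0) \<inter> Ker B = {0} \<and>
      Ker (H_map F b l\<^sub>0 u\<^sub>0) \<inter> Ker Bb = {0} \<and>
      Ker (Dif (G_map F a) x\<^sub>0) = {(g, \<mu>, w). g = 0 \<and> (\<mu>, w) \<in> Ker (Dif F (l\<^sub>0, u\<^sub>0))} \<and>
      Ker (H_map F b l\<^sub>0 u\<^sub>0) = {(e, v). e = 0 \<and> v \<in> Ker (D_u F l\<^sub>0 u\<^sub>0)} \<and>
      \<theta>\<^sub>0 = B x\<^sub>0)
     \<longleftrightarrow>
     (\<exists>(ys\<^sub>0 :: ('q, 'm, 'w) X_space ^ ('q + 'm)) (zs\<^sub>0 :: ('n, 'w) Delta_space ^ 'n).
      (\<forall>i. fst (ys\<^sub>0 $ i) = 0) \<and> (\<forall>k. fst (zs\<^sub>0 $ k) = 0) \<and>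
      S_map F a b B Bb \<theta>\<^sub>0 \<delta> \<delta>' (x\<^sub>0, ys\<^sub>0, zs\<^sub>0) = 0 \<and>
      Psi_map F a B \<theta>\<^sub>0 x\<^sub>0 = 0 \<and>
      isomorphism (Dif (Psi_map F a B \<theta>\<^sub>0) x\<^sub>0) \<and>
      isomorphism (Dif (S_map F a b B Bb \<theta>\<^sub>0 \<delta> \<delta>') (x\<^sub>0, ys\<^sub>0, zs\<^sub>0)))"
    (is "?i \<longleftrightarrow> ?ii")
proof -

  \<comment> \<open>The operators at the base point and the derivative of S\<close>
  obtain F' F'' where F': "\<And>p. (F has_derivative blinfun_apply (F' p)) (at p)"
    and F'': "\<And>p. (F' has_derivative F'' p) (at p)"
    using class_C_imp_second_derivative[OF F p] by blast
  define L where "L = blinfun_apply (F' (l\<^sub>0, u\<^sub>0))"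
  define T where "T = (\<lambda>v. L (0, v))"
  define A where "A = (\<lambda>x. (B x, border L a x))"
  define C where "C = (\<lambda>z. (Bb z, border T b z))"
  have blL: "bounded_linear L" unfolding L_def by (rule blinfun.bounded_linear_right)
  have blT: "bounded_linear T"
    unfolding T_def by (intro bounded_linear_compose[OF blL] bounded_linear_Pair bounded_linear_zero bounded_linear_ident)
  have DF: "Dif F (l\<^sub>0, u\<^sub>0) = L" unfolding L_def by (rule Dif_eq[OF F'])
  have DuF: "D_u F l\<^sub>0 u\<^sub>0 = T" unfolding T_def L_def by (rule D_u_eq[OF F'])
  have H: "H_map F b l\<^sub>0 u\<^sub>0 = border T b" by (simp add: H_map_eq_border DuF)
  have derG: "(border F a has_derivative border L a) (at x\<^sub>0)"
    unfolding L_def using F' by (intro border_has_derivative) (simp add: x0)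
  have DG: "Dif (G_map F a) x\<^sub>0 = border L a"
    unfolding G_map_eq_border by (rule Dif_eq[OF derG])
  have derPsi: "(Psi_map F a B \<theta>\<^sub>0 has_derivative A) (at x\<^sub>0)"
  proof -
    have "((\<lambda>x. (B x - \<theta>\<^sub>0, border F a x)) has_derivative (\<lambda>h. (B h - 0, border L a h))) (at x\<^sub>0)"
      by (intro has_derivative_Pair has_derivative_diff has_derivative_const derG
          bounded_linear.has_derivative[OF B(1)] has_derivative_ident)
    then show ?thesis by (simp add: A_def Psi_map_def[abs_def] G_map_eq_border)
  qed
  have blA: "bounded_linear A" using derPsi by (rule has_derivative_bounded_linear)
  have blC: "bounded_linear C"
  proof -
    \<comment> \<open>\<open>border T b\<close> is its own derivative because \<open>T\<close> is;
      boundedness is then part of differentiability.\<close>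
    have "(border T b has_derivative border T b) (at 0)"
      by (intro border_has_derivative bounded_linear_imp_has_derivative blT)
    then show ?thesis
      unfolding C_def by (intro bounded_linear_Pair Bb(1) has_derivative_bounded_linear)
  qed
  have isoPsi: "isomorphism (Dif (Psi_map F a B \<theta>\<^sub>0) x\<^sub>0) \<longleftrightarrow> bij A"
    unfolding Dif_eq[OF derPsi] by (rule isomorphism_iff_bij[OF blA])
  have linL: "linear L" and linT: "linear T" and linB: "linear B" and linBb: "linear Bb"
    and linA: "linear A" and linC: "linear C"
    using blL blT B(1) Bb(1) blA blC by (auto simp: bounded_linear.linear)
  \<comment> \<open>By triangularity \<open>ys\<close> and \<open>zs\<close> do not affect
    bijectivity, so the condition on DS has the same meaning at every candidate solution.\<close>
  have isoS: "isomorphism (Dif (S_map F a b B Bb \<theta>\<^sub>0 \<delta> \<delta>') (x\<^sub>0, ys, zs)) \<longleftrightarrow> bij C"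
    if A: "bij A" for ys zs
  proof -
    let ?K = "\<lambda>i h. (0 :: real ^ ('q + 'm), F'' (l\<^sub>0, u\<^sub>0) (snd h) (snd (ys $ i)))"
    let ?M = "\<lambda>k h. (0 :: real ^ 'n, F'' (l\<^sub>0, u\<^sub>0) (snd h) (0, snd (zs $ k)))"
    let ?S' = "\<lambda>(x', ys', zs'). (A x', (\<chi> i. A (ys' $ i) + ?K i x'), (\<chi> k. C (zs' $ k) + ?M k x'))"
    have S': "(S_map F a b B Bb \<theta>\<^sub>0 \<delta> \<delta>' has_derivative ?S') (at (x\<^sub>0, ys, zs))"
      using S_map_has_derivative[OF F' F'' B(1) Bb(1), where a = a and b = b and x = "x\<^sub>0"
          and ys = ys and zs = zs and \<theta> = \<theta>\<^sub>0 and \<delta> = \<delta> and \<delta>' = \<delta>']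
      unfolding A_def C_def T_def L_def by (simp only: x0 snd_conv)
    have F0: "F'' (l\<^sub>0, u\<^sub>0) 0 = 0"
      by (rule linear_0[OF has_derivative_linear[OF F'']])
    have "isomorphism (Dif (S_map F a b B Bb \<theta>\<^sub>0 \<delta> \<delta>') (x\<^sub>0, ys, zs)) \<longleftrightarrow> bij ?S'"
      unfolding Dif_eq[OF S'] by (rule isomorphism_iff_bij[OF has_derivative_bounded_linear[OF S']])
    also have "\<dots> \<longleftrightarrow> bij C"
      by (rule bij_block_triangular[OF linA A linC]) (simp_all add: F0 flip: zero_prod_def)
    finally show ?thesis .
  qed
  have Psi0: "Psi_map F a B \<theta>\<^sub>0 x\<^sub>0 = 0 \<longleftrightarrow> \<theta>\<^sub>0 = B x\<^sub>0 \<and> F (l\<^sub>0, u\<^sub>0) = 0"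
    by (auto simp: Psi_map_def G_map_def x0 zero_prod_def)
  have S0: "S_map F a b B Bb \<theta>\<^sub>0 \<delta> \<delta>' (x\<^sub>0, ys, zs) = 0 \<longleftrightarrow>
      Psi_map F a B \<theta>\<^sub>0 x\<^sub>0 = 0 \<and> (\<forall>i. A (ys $ i) = (\<delta> i, 0)) \<and> (\<forall>k. C (zs $ k) = (\<delta>' k, 0))" for ys zs
  proof -
    have "Phi_G F a B x\<^sub>0 = A" by (simp add: fun_eq_iff Phi_G_def A_def DG)
    moreover have "Phi_H F b Bb x\<^sub>0 = C" by (simp add: fun_eq_iff Phi_H_def C_def x0 H)
    ultimately show ?thesis by (simp add: S_map_def vec_lambda_diff_eq_0_iff prod_eq_iff)
  qed
  \<comment> \<open>The intermediate statement \<open>?iii\<close> expresses (ii) by bijectivity of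
    \<open>A\<close> and \<open>C\<close> and by linear equations for the \<open>ys\<close> and
    \<open>zs\<close>.\<close>
  have "?i \<longleftrightarrow> \<theta>\<^sub>0 = B x\<^sub>0 \<and> F (l\<^sub>0, u\<^sub>0) = 0 \<and> bij A \<and> bij C \<and>
      (\<exists>ys zs. (\<forall>i. fst (ys $ i) = 0) \<and> (\<forall>k. fst (zs $ k) = 0) \<and>
        (\<forall>i. A (ys $ i) = (\<delta> i, 0)) \<and> (\<forall>k. C (zs $ k) = (\<delta>' k, 0)))" (is "_ \<longleftrightarrow> ?iii")
  proof
    assume i: ?i
    have dim: "CARD('n) = dim (Ker T)"
      and a_sum: "direct_sum_UNIV (span (range a)) (range L)"
      and b_sum: "direct_sum_UNIV (span (range b)) (range T)"
      and KerG_B: "Ker (border L a) \<inter> Ker B = {0}"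
      and KerH_Bb: "Ker (border T b) \<inter> Ker Bb = {0}"
      and KerG: "Ker (border L a) = {(g, \<mu>, w). g = 0 \<and> (\<mu>, w) \<in> Ker L}"
      and KerH: "Ker (border T b) = {(e, v). e = 0 \<and> v \<in> Ker T}"
      and \<theta>F: "\<theta>\<^sub>0 = B x\<^sub>0" "F (l\<^sub>0, u\<^sub>0) = 0"
      using i unfolding DF DuF DG H by iprover+
    have lin0: "linear (\<lambda>v::'w. (0 :: real ^ 'n, v))" by (simp add: linear_iff)
    \<comment> \<open>The embedding \<open>\<lambda>v. (0, v)\<close> carries the dimension of
      \<open>Ker T\<close> over to \<open>Ker (border T b)\<close>, as the dimension count for
      \<open>C\<close> requires.\<close>
    have "Ker (border T b) = (\<lambda>v. (0, v)) ` Ker T" unfolding KerH by auto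
    moreover have "dim ((\<lambda>v::'w. (0 :: real ^ 'n, v)) ` Ker T) = dim (Ker T)"
    proof -
      obtain c where c: "c \<subseteq> Ker T" "independent c" "Ker T \<subseteq> span c" "card c = dim (Ker T)"
        by (rule basis_exists[of "Ker T"])
      have inj: "inj_on (\<lambda>v::'w. (0 :: real ^ 'n, v)) X" for X by (simp add: inj_on_def)
      have "dim ((\<lambda>v::'w. (0 :: real ^ 'n, v)) ` Ker T) = card ((\<lambda>v::'w. (0 :: real ^ 'n, v)) ` c)"
      proof (rule basis_card_eq_dim[symmetric])
        show "independent ((\<lambda>v::'w. (0 :: real ^ 'n, v)) ` c)"
          by (rule linear_independent_injective_image[OF lin0 c(2) inj])
        show "(\<lambda>v::'w. (0 :: real ^ 'n, v)) ` Ker T \<subseteq> span ((\<lambda>v. (0, v)) ` c)"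
          unfolding linear_span_image[OF lin0] by (rule image_mono[OF c(3)])
      qed (rule image_mono[OF c(1)])
      then show ?thesis using c(4) by (simp add: card_image[OF inj])
    qed
    ultimately have "dim (Ker (border T b)) = CARD('n)" using dim by simp
    then have bijC: "bij C"
      unfolding C_def
      by (rule bij_Pair_if_dim_Ker[OF linear_border[OF linT] linBb surj_border[OF b_sum] KerH_Bb])
    have injA: "inj A"
      unfolding linear_injective_0[OF linA]
    proof (intro allI impI)
      fix x assume "A x = 0"
      then have "x \<in> Ker (border L a) \<inter> Ker B" by (simp add: A_def Ker_def zero_prod_def)
      then show "x = 0" unfolding KerG_B by simp
    qed
    \<comment> \<open>Comparison with the bijective \<open>C\<close> up to finite rank turns
      injectivity of \<open>A\<close> into surjectivity.\<close>
    have "surj A"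
      unfolding A_def using bijC injA unfolding C_def T_def A_def
      by (rule surj_extended_if_inj[OF linL linB linBb])
    with injA have bijA: "bij A" by (rule bijI)
    \<comment> \<open>The linear equations leave no other choice; the kernel descriptions in (i)
      then make the first components vanish.\<close>
    define ys :: "('q, 'm, 'w) X_space ^ ('q + 'm)" where "ys = (\<chi> i. inv A (\<delta> i, 0))"
    define zs :: "('n, 'w) Delta_space ^ 'n" where "zs = (\<chi> k. inv C (\<delta>' k, 0))"
    have ys: "A (ys $ i) = (\<delta> i, 0)" for i
      unfolding ys_def by (simp add: surj_f_inv_f[OF bij_is_surj[OF bijA]])
    have zs: "C (zs $ k) = (\<delta>' k, 0)" for k
      unfolding zs_def by (simp add: surj_f_inv_f[OF bij_is_surj[OF bijC]])
    have "fst (ys $ i) = 0" for i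
    proof -
      have "ys $ i \<in> Ker (border L a)" using ys[of i] by (simp add: A_def Ker_def)
      then show ?thesis unfolding KerG by auto
    qed
    moreover have "fst (zs $ k) = 0" for k
    proof -
      have "zs $ k \<in> Ker (border T b)" using zs[of k] by (simp add: C_def Ker_def)
      then show ?thesis unfolding KerH by auto
    qed
    ultimately show ?iii using \<theta>F bijA bijC ys zs by blast
  next
    assume iii: ?iii
    then obtain ys zs where \<theta>F: "\<theta>\<^sub>0 = B x\<^sub>0" "F (l\<^sub>0, u\<^sub>0) = 0" and bij: "bij A" "bij C"
      and fst0: "\<And>i. fst (ys $ i) = 0" "\<And>k. fst (zs $ k) = 0"
      and yz: "\<And>i. A (ys $ i) = (\<delta> i, 0)" "\<And>k. C (zs $ k) = (\<delta>' k, 0)" by blast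
    have y: "\<And>i. B (ys $ i) = \<delta> i" "\<And>i. border L a (ys $ i) = 0"
      and z: "\<And>k. Bb (zs $ k) = \<delta>' k" "\<And>k. border T b (zs $ k) = 0"
      using yz by (simp_all add: A_def C_def)
    note G = direct_sum_if_regular_extension[OF linL linB bij(1)[unfolded A_def] \<delta> y fst0(1)]
    note H' = direct_sum_if_regular_extension[OF linT linBb bij(2)[unfolded C_def] \<delta>' z fst0(2)]
    have linH: "linear (border T b)" by (rule linear_border[OF linT])
    have KerT: "Ker T = span (range (\<lambda>k. snd (zs $ k)))"
    proof -
      have "Ker T = snd ` Ker (border T b)" unfolding H'(3) by force
      also have "Ker (border T b) = span (range (\<lambda>k. zs $ k))"
        using Ker_eq_span[OF linH linBb bij_is_inj[OF bij(2)[unfolded C_def]] \<delta>' z] .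
      also have "snd ` \<dots> = span (snd ` range (\<lambda>k. zs $ k))"
        by (rule linear_span_image[symmetric]) (simp add: linear_iff)
      finally show ?thesis by (simp add: image_image)
    qed
    \<comment> \<open>The map \<open>\<lambda>v. Bb (0, v)\<close> sends these vectors to the basis
      \<open>\<delta>'\<close>, because the first components of the \<open>zs\<close> are
      zero.\<close>
    have "lin_indep_family (\<lambda>k. snd (zs $ k))"
    proof (rule lin_indep_family_linear_preimage)
      show "linear (\<lambda>v. Bb (0, v))"
        using linear_compose[OF _ linBb, of "\<lambda>v. (0, v)"] by (simp add: o_def linear_iff)
      have "Bb (0, snd (zs $ k)) = \<delta>' k" for k
        using z(1)[of k] fst0(2)[of k] by (metis prod.collapse)
      then show "lin_indep_family (\<lambda>k. Bb (0, snd (zs $ k)))"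
        using \<delta>' by (simp add: basis_family_def)
    qed
    then have dimT: "dim (Ker T) = CARD('n)"
      unfolding KerT by (rule dim_span_lin_indep_family)
    have finT: "finite_dim (Ker T)"
      unfolding finite_dim_def KerT by (intro exI[of _ "range (\<lambda>k. snd (zs $ k))"]) simp
    have closed: "closed (range T)"
      using bij(2) isomorphism_iff_bij[OF blC] unfolding C_def
      by (intro closed_range_if_regular_extension[OF linT linBb _ \<delta>' z fst0(2)]) simp
    \<comment> \<open>The codimensions are q for DF and n for D_uF; the latter agrees with
      \<open>dimT\<close>, which gives index zero.\<close>
    note ca = codim_lin_indep_complement[OF G(1,2)] and cb = codim_lin_indep_complement[OF H'(1,2)]
    have "unique_solution_at (G_map F a) x\<^sub>0"
      unfolding unique_solution_at_def
    proof (intro allI iffI)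
      fix x assume "G_map F a x = 0 \<and> snd x = snd x\<^sub>0"
      then have x: "snd x = (l\<^sub>0, u\<^sub>0)" "(\<Sum>i\<in>UNIV. fst x $ i *\<^sub>R a i) = 0"
        using \<theta>F(2) by (auto simp: G_map_eq_border border_def split_beta x0)
      \<comment> \<open>With the last two components fixed, F vanishes and only a relation between
        the \<open>a i\<close> remains.\<close>
      then have "\<forall>i. fst x $ i = 0" using G(1) unfolding lin_indep_family_iff by blast
      then show "x = x\<^sub>0" using x(1) by (simp add: x0 prod_eq_iff vec_eq_iff)
    qed (simp add: G_map_def x0 \<theta>F(2))
    then show ?i
      unfolding DF DuF DG H fredholm_def fredholm_index_def
      using \<theta>F blT finT closed cb ca dimT G H' by auto
  qed
  \<comment> \<open>The isomorphism condition on D\<Psi> supplies the bijectivity of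
    \<open>A\<close> under which \<open>isoS\<close> holds.\<close>
  also have "?iii \<longleftrightarrow> ?ii"
    unfolding S0 Psi0 isoPsi using isoS by blast
  finally show ?thesis .
qed

end
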